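(* Assume Ostaszewski's $\clubsuit$-principle. Then $CA^\rho$ holds: (i) for every $n\geq2$ and every good type $\tau=\langle m_k,n_{k+1},r_{k+1}\rangle_{k\in\omega}$ with $n_k\geq n$ for all $k\geq1$, there is an $n$-$\rho$-capturing construction scheme of type $\tau$ over $\omega_1$; and (ii) for every good type $\tau$ for which $\langle n_{k+1}\rangle_{k\in\omega}$ is non-decreasing and unbounded, there is a $\rho$-capturing construction scheme of type $\tau$ over $\omega_1$.
   Context: $\clubsuit$: there is a sequence $\langle C_\delta:\delta\in\mathrm{Lim}\rangle$ ($\mathrm{Lim}$ = nonzero countable limit ordinals) with $C_\delta\subseteq\delta$ of order type $\omega$, $\sup C_\delta=\delta$, such that for every uncountable $S\subseteq\omega_1$ the set $\{\delta:C_\delta\subseteq S\}$ is stationary. A type is a sequence $\tau=\langle m_k,n_{k+1},r_{k+1}\rangle_{k\in\omega}$ of natural numbers with $m_0=1$ and, for all $k$, $n_{k+1}\geq2$, $m_k>r_{k+1}$, $m_{k+1}=r_{k+1}+(m_k-r_{k+1})n_{k+1}$; it is good if every $r\in\omega$ equals $r_k$ for infinitely many $k\geq1$. $A<B$ means every element of $A$ is below every element of $B$; $D(a)$ is the $a$-th element of a finite set of ordinals $D$. A construction scheme of type $\tau$ over a set of ordinals $Y$ is a family $\mathcal{F}$ of nonempty finite subsets of $Y$, cofinal among finite subsets of $Y$ under $\subseteq$, each member of size $m_k$ for some $k$, such that with $\mathcal{F}_k=\{F\in\mathcal{F}:|F|=m_k\}$: (i) for $E,F\in\mathcal{F}_k$,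 $E\cap F$ is an initial segment of both; (ii) every $F\in\mathcal{F}_{k+1}$ equals $F_0\cup\dots\cup F_{n_{k+1}-1}$ with $F_i\in\mathcal{F}_k$ a $\Delta$-system with root $R(F)$, $|R(F)|=r_{k+1}$, $R(F)<F_0\setminus R(F)<\dots<F_{n_{k+1}-1}\setminus R(F)$ (unique decomposition). $\rho(\alpha,\beta)=\min\{k:\exists F\in\mathcal{F}_k\ \{\alpha,\beta\}\subseteq F\}$. For $k\geq1$, $\Xi_\alpha(k)=-1$ if $\alpha\in R(F)$, $=i$ if $\alpha\in F_i\setminus R(F)$, for any $F\in\mathcal{F}_k$ with $\alpha\in F$ (independent of $F$). A root-tail-tail $\Delta$-system is a sequence $\langle D_i\rangle_{i<n}$, $n\geq2$, of finite sets of ordinals of common size $m$ with pairwise intersections $R$, $R<D_i\setminus R$, and $D_0\setminus R<\dots<D_{n-1}\setminus R$; $r=|R|$. It is $\rho$-captured at level $l\geq1$ if $n\leq n_l$ and (I) for all $i<n$, $a<m$: $\Xi_{D_i(a)}(l)=-1$ if $a<r$ and $=i$ if $a\geq r$; (II) $\rho(D_i(a),D_j(a))=l$ for $i<j<n$, $r\leq a<m$. A scheme over $\omega_1$ is $n$-$\rho$-capturing if for every uncountable family $\mathcal{S}$ of nonempty finite subsets of $\omega_1$ there are infinitely many $l$ for which some $n$ distinct members of $\mathcal{S}$, suitably enumerated, form a root-tail-tail $\Delta$-system $\rho$-captured at level $l$; it is $\rho$-capturing if it is $n$-$\rho$-capturing for all $n\geq2$. *)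

theory Defs
  imports Main "HOL-Library.Countable_Set"
begin

text \<open>A well-ordered type is omega_1-like if it is uncountable while every proper
initial segment is countable; any such type is order-isomorphic to omega_1.\<close>
definition omega1_like :: "'a::wellorder itself \<Rightarrow> bool" where
  "omega1_like _ \<longleftrightarrow> \<not> countable (UNIV :: 'a set) \<and> (\<forall>x::'a. countable {y. y < x})"

definition is_lim :: "'a::wellorder \<Rightarrow> bool" where
  "is_lim \<delta> \<longleftrightarrow> (\<exists>\<beta>. \<beta> < \<delta>) \<and> (\<forall>\<beta><\<delta>. \<exists>\<gamma>. \<beta> < \<gamma> \<and> \<gamma> < \<delta>)"

definition club :: "'a::wellorder set \<Rightarrow> bool" where
  "club C \<longleftrightarrow> (\<forall>\<beta>. \<exists>\<gamma>\<in>C. \<beta> < \<gamma>) \<and>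
     (\<forall>\<delta>. is_lim \<delta> \<and> (\<forall>\<beta><\<delta>. \<exists>\<gamma>\<in>C. \<beta> < \<gamma> \<and> \<gamma> < \<delta>) \<longrightarrow> \<delta> \<in> C)"

definition stationary :: "'a::wellorder set \<Rightarrow> bool" where
  "stationary S \<longleftrightarrow> (\<forall>C. club C \<longrightarrow> S \<inter> C \<noteq> {})"

definition order_type_omega :: "'a::wellorder set \<Rightarrow> bool" where
  "order_type_omega C \<longleftrightarrow> infinite C \<and> (\<forall>x\<in>C. finite {y\<in>C. y < x})"

definition clubsuit :: "'a::wellorder itself \<Rightarrow> bool" where
  "clubsuit _ \<longleftrightarrow> (\<exists>Cs :: 'a \<Rightarrow> 'a set.
     (\<forall>\<delta>. is_lim \<delta> \<longrightarrow> Cs \<delta> \<subseteq> {\<beta>. \<beta> < \<delta>} \<and> order_type_omega (Cs \<delta>) \<and>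
                       (\<forall>\<beta><\<delta>. \<exists>\<gamma>\<in>Cs \<delta>. \<beta> \<le> \<gamma>)) \<and>
     (\<forall>S :: 'a set. \<not> countable S \<longrightarrow> stationary {\<delta>. is_lim \<delta> \<and> Cs \<delta> \<subseteq> S}))"

text \<open>A type is given by three sequences m, n, r; only n (k+1), r (k+1) are used.\<close>
definition is_type :: "(nat \<Rightarrow> nat) \<Rightarrow> (nat \<Rightarrow> nat) \<Rightarrow> (nat \<Rightarrow> nat) \<Rightarrow> bool" where
  "is_type m n r \<longleftrightarrow> m 0 = 1 \<and>
     (\<forall>k. n (Suc k) \<ge> 2 \<and> m k > r (Suc k) \<and>
          m (Suc k) = r (Suc k) + (m k - r (Suc k)) * n (Suc k))"

definition good_type :: "(nat \<Rightarrow> nat) \<Rightarrow> (nat \<Rightarrow> nat) \<Rightarrow> (nat \<Rightarrow> nat) \<Rightarrow> bool" where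
  "good_type m n r \<longleftrightarrow> is_type m n r \<and> (\<forall>x. infinite {k. k \<ge> 1 \<and> r k = x})"

definition setless :: "'a::linorder set \<Rightarrow> 'a set \<Rightarrow> bool" where
  "setless A B \<longleftrightarrow> (\<forall>x\<in>A. \<forall>y\<in>B. x < y)"

definition elem :: "'a::linorder set \<Rightarrow> nat \<Rightarrow> 'a" where
  "elem D a = sorted_list_of_set D ! a"

definition init_seg :: "'a::linorder set \<Rightarrow> 'a set \<Rightarrow> bool" where
  "init_seg A F \<longleftrightarrow> A \<subseteq> F \<and> (\<forall>x\<in>A. \<forall>y\<in>F. y < x \<longrightarrow> y \<in> A)"

definition level :: "(nat \<Rightarrow> nat) \<Rightarrow> 'a set set \<Rightarrow> nat \<Rightarrow> 'a set set" where
  "level m \<F> k = {F\<in>\<F>. card F = m k}"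

definition decomp :: "(nat \<Rightarrow> nat) \<Rightarrow> (nat \<Rightarrow> nat) \<Rightarrow> (nat \<Rightarrow> nat) \<Rightarrow> 'a::linorder set set \<Rightarrow>
    nat \<Rightarrow> 'a set \<Rightarrow> 'a set \<Rightarrow> (nat \<Rightarrow> 'a set) \<Rightarrow> bool" where
  "decomp m n r \<F> k F R Fs \<longleftrightarrow>
     F = (\<Union>i<n (Suc k). Fs i) \<and>
     (\<forall>i<n (Suc k). Fs i \<in> level m \<F> k) \<and>
     (\<forall>i<n (Suc k). \<forall>j<n (Suc k). i \<noteq> j \<longrightarrow> Fs i \<inter> Fs j = R) \<and>
     card R = r (Suc k) \<and>
     setless R (Fs 0 - R) \<and>
     (\<forall>i. Suc i < n (Suc k) \<longrightarrow> setless (Fs i - R) (Fs (Suc i) - R))"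

definition construction_scheme :: "(nat \<Rightarrow> nat) \<Rightarrow> (nat \<Rightarrow> nat) \<Rightarrow> (nat \<Rightarrow> nat) \<Rightarrow>
    'a::linorder set \<Rightarrow> 'a set set \<Rightarrow> bool" where
  "construction_scheme m n r Y \<F> \<longleftrightarrow>
     (\<forall>F\<in>\<F>. F \<noteq> {} \<and> finite F \<and> F \<subseteq> Y \<and> (\<exists>k. card F = m k)) \<and>
     (\<forall>A. finite A \<and> A \<subseteq> Y \<longrightarrow> (\<exists>F\<in>\<F>. A \<subseteq> F)) \<and>
     (\<forall>k. \<forall>E\<in>level m \<F> k. \<forall>F\<in>level m \<F> k. init_seg (E \<inter> F) E \<and> init_seg (E \<inter> F) F) \<and>
     (\<forall>k. \<forall>F\<in>level m \<F> (Suc k). \<exists>R Fs. decomp m n r \<F> k F R Fs)"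

definition rho :: "(nat \<Rightarrow> nat) \<Rightarrow> 'a set set \<Rightarrow> 'a \<Rightarrow> 'a \<Rightarrow> nat" where
  "rho m \<F> \<alpha> \<beta> = (LEAST k. \<exists>F\<in>level m \<F> k. {\<alpha>, \<beta>} \<subseteq> F)"

text \<open>Xi_alpha(k) = i (for k \<ge> 1), with -1 encoding membership in the root; witnessed by
some F of level k containing alpha (the paper shows the value is independent of F).\<close>
definition Xi_is :: "(nat \<Rightarrow> nat) \<Rightarrow> (nat \<Rightarrow> nat) \<Rightarrow> (nat \<Rightarrow> nat) \<Rightarrow> 'a::linorder set set \<Rightarrow>
    'a \<Rightarrow> nat \<Rightarrow> int \<Rightarrow> bool" where
  "Xi_is m n r \<F> \<alpha> k i \<longleftrightarrow> k \<ge> 1 \<and>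
     (\<exists>F\<in>level m \<F> k. \<exists>R Fs. decomp m n r \<F> (k - 1) F R Fs \<and> \<alpha> \<in> F \<and>
        ((\<alpha> \<in> R \<and> i = -1) \<or> (\<alpha> \<notin> R \<and> i \<ge> 0 \<and> \<alpha> \<in> Fs (nat i))))"

definition rtt_delta :: "(nat \<Rightarrow> 'a::linorder set) \<Rightarrow> nat \<Rightarrow> nat \<Rightarrow> 'a set \<Rightarrow> bool" where
  "rtt_delta D len msz R \<longleftrightarrow> len \<ge> 2 \<and>
     (\<forall>i<len. finite (D i) \<and> card (D i) = msz) \<and>
     (\<forall>i<len. \<forall>j<len. i \<noteq> j \<longrightarrow> D i \<inter> D j = R) \<and>
     (\<forall>i<len. setless R (D i - R)) \<and>
     (\<forall>i. Suc i < len \<longrightarrow> setless (D i - R) (D (Suc i) - R))"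

definition rho_captured :: "(nat \<Rightarrow> nat) \<Rightarrow> (nat \<Rightarrow> nat) \<Rightarrow> (nat \<Rightarrow> nat) \<Rightarrow> 'a::linorder set set \<Rightarrow>
    (nat \<Rightarrow> 'a set) \<Rightarrow> nat \<Rightarrow> nat \<Rightarrow> bool" where
  "rho_captured m n r \<F> D len l \<longleftrightarrow> l \<ge> 1 \<and>
     (\<exists>msz R. rtt_delta D len msz R \<and> len \<le> n l \<and>
        (\<forall>i<len. \<forall>a<msz. Xi_is m n r \<F> (elem (D i) a) l
                              (if a < card R then -1 else int i)) \<and>
        (\<forall>i j a. i < j \<and> j < len \<and> card R \<le> a \<and> a < msz \<longrightarrow>
                 rho m \<F> (elem (D i) a) (elem (D j) a) = l))"

definition n_rho_capturing :: "nat \<Rightarrow> (nat \<Rightarrow> nat) \<Rightarrow> (nat \<Rightarrow> nat) \<Rightarrow> (nat \<Rightarrow> nat) \<Rightarrow>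
    'a::linorder set set \<Rightarrow> bool" where
  "n_rho_capturing len m n r \<F> \<longleftrightarrow>
     (\<forall>\<S>. \<not> countable \<S> \<and> (\<forall>S\<in>\<S>. S \<noteq> {} \<and> finite S) \<longrightarrow>
        infinite {l. \<exists>D. inj_on D {..<len} \<and> D ` {..<len} \<subseteq> \<S> \<and> rho_captured m n r \<F> D len l})"

definition rho_capturing :: "(nat \<Rightarrow> nat) \<Rightarrow> (nat \<Rightarrow> nat) \<Rightarrow> (nat \<Rightarrow> nat) \<Rightarrow>
    'a::linorder set set \<Rightarrow> bool" where
  "rho_capturing m n r \<F> \<longleftrightarrow> (\<forall>len\<ge>2. n_rho_capturing len m n r \<F>)"

end

theory Submission
  imports Defs
begin

text \<open>
  A scheme is encoded by the hulls \<open>h b k = {x \<le> b. \<rho>(x, b) \<le> k}\<close>, which are built by recursion on \<open>b\<close>.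
  A successor follows its predecessor at all large levels. A limit \<open>d\<close> follows points \<open>z\<^sub>0, z\<^sub>1, \<dots>\<close>
  below it: its hull is that of \<open>z\<^sub>i\<close> plus \<open>d\<close> until a level \<open>l\<close> whose root size \<open>r\<^sub>l\<close> equals the size of
  the hull of \<open>z\<^sub>i\<close>. There \<open>d\<close> may enter any piece of a level-\<open>l\<close> set whose root is this hull, and then
  follows the last point \<open>z\<^sub>i\<^sub>+\<^sub>1\<close> before it. Goodness of the type makes such levels available again and
  again, so \<open>d\<close> can meet countably many requirements.

  The principle \<open>\<clubsuit>\<close> enters through iterated guessing. For an uncountable \<open>\<Delta>\<close>-system with tails in \<open>\<W>\<close>,
  there are unboundedly many \<open>d\<close> guessing pairs \<open>(d', W)\<close> with \<open>d' < W \<in> \<W>\<close>, where \<open>d'\<close> itself guesses such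
  pairs, and so on \<open>s\<close> times. If every guessed \<open>d'\<close> lies in piece \<open>s\<close> next to a tuple of length \<open>s\<close>
  from \<open>\<W>\<close>, at levels and over roots that later points can still reach, then \<open>d\<close> can be placed in
  piece \<open>s + 1\<close>. Everything above \<open>d\<close> is in the same piece as \<open>d\<close> at all large levels, so any tail above
  \<open>d\<close> completes a \<open>\<rho>\<close>-captured tuple.
\<close>

section \<open>Coherent hulls\<close>

locale scheme_type =
  fixes m n r :: "nat \<Rightarrow> nat"
  assumes good: "good_type m n r"
begin

section \<open>Ranks in a level-\<open>k + 1\<close> set, its root and its pieces\<close>

definition width :: "nat \<Rightarrow> nat" where
  "width k = m k - r (Suc k)"

text \<open>Elements of a level-\<open>k + 1\<close> set are ranked from 1; \<open>block k\<close> sends a rank to 0 for the root and to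
  \<open>i + 1\<close> for the piece \<open>F\<^sub>i\<close>, and \<open>proj k\<close> is the rank inside the level-\<open>k\<close> piece.\<close>

definition block :: "nat \<Rightarrow> nat \<Rightarrow> nat" where
  "block k q = (if q \<le> r (Suc k) then 0 else Suc ((q - Suc (r (Suc k))) div width k))"

definition proj :: "nat \<Rightarrow> nat \<Rightarrow> nat" where
  "proj k q = (if q \<le> r (Suc k) then q else r (Suc k) + Suc ((q - Suc (r (Suc k))) mod width k))"

lemma r_less_m: "r (Suc k) < m k"
  and n_ge_2: "n (Suc k) \<ge> 2"
  using good unfolding good_type_def is_type_def by auto

lemma width_pos: "width k > 0"
  unfolding width_def using r_less_m[of k] by simp

lemma m_eq: "m k = r (Suc k) + width k"
  unfolding width_def using r_less_m[of k] by simp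

lemma m_Suc: "m (Suc k) = r (Suc k) + width k * n (Suc k)"
  using good unfolding good_type_def is_type_def width_def by auto

lemma m_less_Suc: "m k < m (Suc k)"
proof -
  have "width k * 2 \<le> width k * n (Suc k)" using n_ge_2[of k] by simp
  then show ?thesis using m_eq[of k] m_Suc[of k] width_pos[of k] by simp
qed

lemma m_strict_mono: "strict_mono m"
  using m_less_Suc by (simp add: strict_mono_Suc_iff)

lemma m_pos: "m k > 0"
  using r_less_m[of k] by simp

lemma r_infinitely_often: "\<exists>k>K. r (Suc k) = x"
proof -
  have "infinite {k. k \<ge> 1 \<and> r k = x}"
    using good unfolding good_type_def by auto
  then obtain k where "k > Suc K" "r k = x"
    by (metis (mono_tags, lifting) infinite_nat_iff_unbounded mem_Collect_eq)
  then show ?thesis by (cases k) auto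
qed

lemma block_mono: "p \<le> q \<Longrightarrow> block k p \<le> block k q"
  unfolding block_def by (auto intro!: div_le_mono)

lemma block_eq_0: "block k q = 0 \<longleftrightarrow> q \<le> r (Suc k)"
  unfolding block_def by auto

lemma block_eq_0_proj: "block k q = 0 \<longleftrightarrow> proj k q \<le> r (Suc k)"
  unfolding block_def proj_def by auto

lemma proj_le: "proj k q \<le> m k"
  unfolding proj_def using m_eq[of k] width_pos[of k]
  by (auto simp: Suc_le_eq)

lemma block_le_n: "q \<le> m (Suc k) \<Longrightarrow> block k q \<le> n (Suc k)"
proof -
  assume q: "q \<le> m (Suc k)"
  show ?thesis
  proof (cases "q \<le> r (Suc k)")
    case False
    then have "q - Suc (r (Suc k)) < n (Suc k) * width k"
      using q m_Suc[of k] by (simp add: mult.commute)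
    then have "(q - Suc (r (Suc k))) div width k < n (Suc k)"
      by (rule less_mult_imp_div_less)
    then show ?thesis using False by (simp add: block_def)
  qed (simp add: block_def)
qed

text \<open>This rank is the last one of its block: after the shift by
  \<open>Suc (r (Suc k))\<close> it leaves the largest possible remainder,
  \<open>width k - 1\<close>.\<close>

lemma block_end:
  assumes "1 \<le> i"
  shows "block k (r (Suc k) + i * width k) = i" and "proj k (r (Suc k) + i * width k) = m k"
proof -
  obtain i' where i: "i = Suc i'" using assms by (cases i) auto
  obtain v where v: "width k = Suc v" using width_pos[of k] by (cases "width k") auto
  have e: "r (Suc k) + i * width k - Suc (r (Suc k)) = v + i' * width k"
    using i v by simp
  have "(v + i' * width k) div width k = i'" "(v + i' * width k) mod width k = v"
    using v by (simp_all del: mult_Suc_right)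
  moreover have "\<not> r (Suc k) + i * width k \<le> r (Suc k)" using i v by simp
  ultimately show "block k (r (Suc k) + i * width k) = i" "proj k (r (Suc k) + i * width k) = m k"
    unfolding block_def proj_def e using i v m_eq[of k] by simp_all
qed

lemma block_le_end: "block k q = i \<Longrightarrow> 1 \<le> i \<Longrightarrow> q \<le> r (Suc k) + i * width k"
proof -
  assume a: "block k q = i" "1 \<le> i"
  let ?x = "q - Suc (r (Suc k))"
  have q: "\<not> q \<le> r (Suc k)" and i: "i = Suc (?x div width k)" using a by (auto simp: block_def split: if_splits)
  have "?x = (?x div width k) * width k + ?x mod width k" by simp
  moreover have "?x mod width k < width k" using width_pos by simp
  ultimately have "?x < ?x div width k * width k + width k" by linarith
  then have "?x < i * width k" unfolding i by simp
  then show ?thesis using q by linarith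
qed

text \<open>Since the remainder stays below \<open>width k\<close>, adding one does not change the
  quotient. This is what lets a new top point inherit the piece of the point it follows.\<close>

lemma block_Suc:
  assumes "proj k q < m k" "block k q \<noteq> 0"
  shows "block k (Suc q) = block k q"
proof -
  have q: "\<not> q \<le> r (Suc k)" using assms(2) by (simp add: block_eq_0)
  then have "Suc ((q - Suc (r (Suc k))) mod width k) < width k"
    using assms(1) m_eq[of k] by (simp add: proj_def)
  then have "Suc (q - Suc (r (Suc k))) div width k = (q - Suc (r (Suc k))) div width k"
    by (simp add: div_Suc mod_Suc)
  moreover have "Suc q - Suc (r (Suc k)) = Suc (q - Suc (r (Suc k)))" using q by simp
  ultimately show ?thesis using q by (simp add: block_def)
qed

lemma block_Suc_root: "block k (Suc (r (Suc k))) = 1"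
  by (simp add: block_def)

lemma proj_full: "proj k (m (Suc k)) = m k"
  using block_end(2)[of "n (Suc k)" k] n_ge_2[of k] m_Suc[of k] by (simp add: mult.commute)

lemma proj_less_imp: "proj k q < m k \<Longrightarrow> q \<le> m (Suc k) \<Longrightarrow> q < m (Suc k)"
  using proj_full[of k] by (cases "q = m (Suc k)") auto

text \<open>For \<open>q\<close> beyond the root, these ranks form two intervals, the root and the
  beginning of the block of \<open>q\<close>, whose lengths add up to \<open>proj k q\<close>. So
  \<open>proj\<close> is indeed the rank after passing to the level-\<open>k\<close> piece.\<close>

lemma card_block_proj: "card {p \<in> {1..q}. block k p = 0 \<or> block k p = block k q} = proj k q"
proof (cases "q \<le> r (Suc k)")
  case True
  then have "{p \<in> {1..q}. block k p = 0 \<or> block k p = block k q} = {1..q}"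
    by (auto simp: block_def)
  then show ?thesis using True by (simp add: proj_def)
next
  case False
  define R where "R = r (Suc k)"
  define x where "x = q - Suc R"
  define i where "i = x div width k"
  define j where "j = x mod width k"
  have x: "x = i * width k + j" "j < width k" unfolding i_def j_def using width_pos by auto
  have q: "q = R + Suc (i * width k + j)" using False x unfolding x_def R_def by simp
  have "block k p = block k q \<longleftrightarrow> R + Suc (i * width k) \<le> p" if "p \<le> q" "\<not> p \<le> R" for p
  proof -
    have "block k p = block k q \<longleftrightarrow> (p - Suc R) div width k = i"
      using that False by (simp add: block_def R_def[symmetric] i_def x_def)
    also have "\<dots> \<longleftrightarrow> i * width k \<le> p - Suc R"
    proof
      assume "(p - Suc R) div width k = i"
      then show "i * width k \<le> p - Suc R" by (metis div_times_less_eq_dividend)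
    next
      assume a: "i * width k \<le> p - Suc R"
      have "p - Suc R \<le> x" unfolding x_def using that by simp
      then have "(p - Suc R) div width k \<le> i" unfolding i_def by (rule div_le_mono)
      moreover have "i \<le> (p - Suc R) div width k"
        using a width_pos[of k] by (simp add: less_eq_div_iff_mult_less_eq)
      ultimately show "(p - Suc R) div width k = i" by simp
    qed
    also have "\<dots> \<longleftrightarrow> R + Suc (i * width k) \<le> p" using that by auto
    finally show ?thesis .
  qed
  then have iff: "block k p = 0 \<or> block k p = block k q \<longleftrightarrow> p \<le> R \<or> R + Suc (i * width k) \<le> p" if "p \<le> q" for p
    using that by (cases "p \<le> R") (auto simp: block_eq_0 R_def[symmetric])
  have "{p \<in> {1..q}. block k p = 0 \<or> block k p = block k q} = {1..R} \<union> {R + Suc (i * width k)..q}"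
  proof (rule set_eqI)
    fix p
    show "p \<in> {p \<in> {1..q}. block k p = 0 \<or> block k p = block k q}
      \<longleftrightarrow> p \<in> {1..R} \<union> {R + Suc (i * width k)..q}"
      using iff[of p] q by (cases "p \<le> q") auto
  qed
  moreover have "card ({1..R} \<union> {R + Suc (i * width k)..q}) = R + Suc j"
    using q by (subst card_Un_disjoint) auto
  ultimately show ?thesis using False
    by (simp add: proj_def R_def[symmetric] x_def[symmetric] j_def)
qed

text \<open>Here \<open>h b k\<close> plays the role of \<open>{x \<le> b. \<rho>(x, b) \<le> k}\<close>, the part below \<open>b\<close> of any level-\<open>k\<close> set
  through \<open>b\<close>, so \<open>xi h k x = \<Xi>\<^sub>x(k + 1) + 1\<close>.\<close>

definition xi :: "('a::wellorder \<Rightarrow> nat \<Rightarrow> 'a set) \<Rightarrow> nat \<Rightarrow> 'a \<Rightarrow> nat" where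
  "xi h k x = block k (card (h x (Suc k)))"

text \<open>The clauses on \<open>h g k\<close> and on level \<open>Suc k\<close> encode the two
  axioms of a scheme: intersections are initial segments, and a piece is the root together with one
  block. The last clause gives cofinality. Everything is stated for a single \<open>b\<close>, so
  that hulls can be built point by point.\<close>

definition coherent :: "('a::wellorder \<Rightarrow> nat \<Rightarrow> 'a set) \<Rightarrow> 'a \<Rightarrow> bool" where
  "coherent h b \<longleftrightarrow>
     (\<forall>k. b \<in> h b k \<and> finite (h b k) \<and> h b k \<subseteq> {..b} \<and> card (h b k) \<le> m k \<and>
          (\<forall>g\<in>h b k. h g k = h b k \<inter> {..g}) \<and>
          h b k = {x \<in> h b (Suc k). xi h k x = 0 \<or> xi h k x = xi h k b}) \<and>
     (\<forall>g\<le>b. \<exists>k. g \<in> h b k)"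

lemma
  assumes "coherent h b"
  shows coherent_self: "b \<in> h b k"
    and coherent_finite: "finite (h b k)"
    and coherent_le: "x \<in> h b k \<Longrightarrow> x \<le> b"
    and coherent_card: "card (h b k) \<le> m k"
    and coherent_restrict: "g \<in> h b k \<Longrightarrow> h g k = h b k \<inter> {..g}"
    and coherent_down: "h b k = {x \<in> h b (Suc k). xi h k x = 0 \<or> xi h k x = xi h k b}"
    and coherent_cover: "g \<le> b \<Longrightarrow> \<exists>k. g \<in> h b k"
  using assms unfolding coherent_def by blast+

lemma coherent_sub: "coherent h b \<Longrightarrow> g \<in> h b k \<Longrightarrow> h g k \<subseteq> h b k"
  using coherent_restrict by blast

lemma coherent_xi: "coherent h b \<Longrightarrow> x \<in> h b k \<Longrightarrow> xi h k x = 0 \<or> xi h k x = xi h k b"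
  using coherent_down by blast

lemma coherent_mono: "coherent h b \<Longrightarrow> k \<le> l \<Longrightarrow> h b k \<subseteq> h b l"
  by (rule lift_Suc_mono_le[of "h b"]) (use coherent_down in blast)+

section \<open>Ranks, pieces and full hulls\<close>

lemma rank_less:
  assumes "coherent h b" "x \<in> h b k" "y \<in> h b k" "x < y"
  shows "card (h x k) < card (h y k)"
proof (rule psubset_card_mono)
  show "finite (h y k)" using assms coherent_restrict[OF assms(1)] coherent_finite[OF assms(1)] by simp
  show "h x k \<subset> h y k"
  proof
    show "h x k \<subseteq> h y k"
      unfolding coherent_restrict[OF assms(1,2)] coherent_restrict[OF assms(1,3)] using assms(4) by auto
    have "y \<in> h y k" "y \<notin> h x k"
      unfolding coherent_restrict[OF assms(1,2)] coherent_restrict[OF assms(1,3)] using assms(3,4) by auto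
    then show "h x k \<noteq> h y k" by auto
  qed
qed

lemma rank_less_iff:
  assumes "coherent h b" "x \<in> h b k" "y \<in> h b k"
  shows "card (h x k) < card (h y k) \<longleftrightarrow> x < y"
  using rank_less[OF assms(1,2,3)] rank_less[OF assms(1,3,2)]
  by (cases x y rule: linorder_cases) auto

text \<open>Ranks strictly increase along \<open>B\<close>, so they are \<open>card B\<close>
  distinct numbers in \<open>{1..card B}\<close>. Coherence is not assumed, so this also applies to
  a hull that is still under construction.\<close>

lemma rank_bij_restrict:
  fixes B :: "'a::wellorder set"
  assumes fin: "finite B" and restr: "\<And>x. x \<in> B \<Longrightarrow> h x k = B \<inter> {..x}"
  shows "bij_betw (\<lambda>x. card (h x k)) B {1..card B}"
proof -
  have "card (h x k) < card (h y k)" if "x \<in> B" "y \<in> B" "x < y" for x y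
  proof (rule psubset_card_mono)
    show "finite (h y k)" using restr that fin by simp
    have "y \<in> h y k" "y \<notin> h x k" "h x k \<subseteq> h y k" using restr that by auto
    then show "h x k \<subset> h y k" by auto
  qed
  then have inj: "inj_on (\<lambda>x. card (h x k)) B"
    by (intro linorder_inj_onI) fastforce+
  have "(\<lambda>x. card (h x k)) ` B \<subseteq> {1..card B}"
  proof
    fix c assume "c \<in> (\<lambda>x. card (h x k)) ` B"
    then obtain x where x: "x \<in> B" "c = card (h x k)" by auto
    have "finite (h x k)" "x \<in> h x k" "h x k \<subseteq> B"
      using x restr fin by auto
    then show "c \<in> {1..card B}"
      using x fin by (auto simp: Suc_le_eq card_gt_0_iff intro: card_mono)
  qed
  moreover have "card ((\<lambda>x. card (h x k)) ` B) = card {1..card B}"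
    using card_image[OF inj] by simp
  ultimately have "(\<lambda>x. card (h x k)) ` B = {1..card B}"
    by (intro card_subset_eq) auto
  then show ?thesis using inj by (simp add: bij_betw_def)
qed

lemma rank_bij: "coherent h b \<Longrightarrow> bij_betw (\<lambda>x. card (h x k)) (h b k) {1..card (h b k)}"
  by (rule rank_bij_restrict) (simp_all add: coherent_finite coherent_restrict)

lemma card_down:
  assumes "bij_betw (\<lambda>x. card (h x (Suc k))) B {1..q}"
  shows "card {x \<in> B. xi h k x = 0 \<or> xi h k x = block k q} = proj k q"
proof -
  let ?f = "\<lambda>x. card (h x (Suc k))"
  let ?P = "\<lambda>p. block k p = 0 \<or> block k p = block k q"
  have "?f ` {x \<in> B. ?P (?f x)} = {p \<in> {1..q}. ?P p}"
    using assms by (auto simp: bij_betw_def)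
  moreover have "inj_on ?f {x \<in> B. ?P (?f x)}"
    using assms by (auto simp: bij_betw_def inj_on_def)
  ultimately have "card {x \<in> B. ?P (?f x)} = card {p \<in> {1..q}. ?P p}"
    using card_image[of ?f "{x \<in> B. ?P (?f x)}"] by presburger
  then show ?thesis unfolding xi_def card_block_proj .
qed

lemma card_proj:
  assumes "coherent h b"
  shows "card (h b k) = proj k (card (h b (Suc k)))"
  using card_down[OF rank_bij[OF assms]] coherent_down[OF assms, of k] by (simp add: xi_def)

text \<open>Projection preserves the ranks of the root, so membership in the root of level
  \<open>k + 1\<close> can be read off from the level-\<open>k\<close> hull.\<close>

lemma xi_eq_0: "coherent h b \<Longrightarrow> xi h k b = 0 \<longleftrightarrow> card (h b k) \<le> r (Suc k)"
  using card_proj[of h b k] by (simp add: xi_def block_eq_0_proj)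

lemma xi_le_n: "coherent h b \<Longrightarrow> xi h k b \<le> n (Suc k)"
  by (simp add: xi_def block_le_n coherent_card)

lemma xi_mono:
  assumes "coherent h b" "x \<in> h b (Suc k)" "y \<in> h b (Suc k)" "x \<le> y"
  shows "xi h k x \<le> xi h k y"
  unfolding xi_def using rank_less[OF assms(1-3)] assms(4)
  by (intro block_mono) (auto simp: le_less)

text \<open>Blocks increase along a hull, so below a point of the root or of
  \<open>F\<^sub>0\<close> there are only points of the root and of \<open>F\<^sub>0\<close>.
  Passing to level \<open>k\<close> therefore removes nothing.\<close>

lemma xi_le_1_down:
  assumes "coherent h b" "xi h k b \<le> 1"
  shows "h b (Suc k) = h b k"
proof -
  have "xi h k x = 0 \<or> xi h k x = xi h k b" if "x \<in> h b (Suc k)" for x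
    using xi_mono[OF assms(1) that coherent_self[OF assms(1)] coherent_le[OF assms(1) that]] assms(2)
    by linarith
  then show ?thesis using coherent_down[OF assms(1), of k] by blast
qed

text \<open>The last rank projects to the last rank, so a hull that is full at level
  \<open>Suc k\<close> is full at level \<open>k\<close>. Once there is room above \<open>b\<close>,
  there is room at all higher levels.\<close>

lemma not_full_Suc: "coherent h b \<Longrightarrow> card (h b k) < m k \<Longrightarrow> card (h b (Suc k)) < m (Suc k)"
  using card_proj[of h b k] proj_less_imp coherent_card[of h b] by metis

lemma not_full_mono: "coherent h b \<Longrightarrow> card (h b k) < m k \<Longrightarrow> k \<le> l \<Longrightarrow> card (h b l) < m l"
proof (induction l)
  case (Suc l)
  then show ?case using not_full_Suc by (metis le_Suc_eq)
qed simp

lemma rank_exists: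
  assumes "coherent h b" "1 \<le> q" "q \<le> card (h b k)"
  shows "\<exists>x\<in>h b k. card (h x k) = q"
proof -
  have "q \<in> (\<lambda>x. card (h x k)) ` h b k"
    using rank_bij[OF assms(1), of k] assms(2,3) by (simp add: bij_betw_def)
  then show ?thesis by auto
qed

text \<open>The witness is the last element of piece \<open>i\<close>, found by its rank; its
  level-\<open>k\<close> hull is the whole piece together with the root.\<close>

lemma full_block:
  assumes c: "\<And>x. x \<le> b \<Longrightarrow> coherent h x" and full: "card (h b (Suc k)) = m (Suc k)"
    and i: "1 \<le> i" "i \<le> n (Suc k)"
  shows "\<exists>f\<in>h b (Suc k). xi h k f = i \<and> card (h f k) = m k \<and>
           h f k = {x \<in> h b (Suc k). xi h k x = 0 \<or> xi h k x = i}"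
proof -
  have cb: "coherent h b" using c by simp
  have "r (Suc k) + i * width k \<le> m (Suc k)"
    using i m_Suc[of k] by (simp add: mult.commute)
  moreover have "1 \<le> r (Suc k) + i * width k" using i width_pos[of k] by (cases i) auto
  ultimately obtain f where f: "f \<in> h b (Suc k)" "card (h f (Suc k)) = r (Suc k) + i * width k"
    using rank_exists[OF cb] full by metis
  have cf: "coherent h f" using c coherent_le[OF cb f(1)] by simp
  have xf: "xi h k f = i" unfolding xi_def f(2) using block_end i by simp
  have "x \<le> f" if "x \<in> h b (Suc k)" "xi h k x = 0 \<or> xi h k x = i" for x
  proof (rule ccontr)
    assume "\<not> x \<le> f"
    then have l: "card (h f (Suc k)) < card (h x (Suc k))"
      using rank_less[OF cb f(1) that(1)] by simp
    then have "xi h k x \<noteq> 0" using f(2) by (simp add: xi_def block_eq_0)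
    then have "card (h x (Suc k)) \<le> r (Suc k) + i * width k"
      using that(2) i(1) by (intro block_le_end) (auto simp: xi_def)
    then show False using l f(2) by simp
  qed
  then have "h f k = {x \<in> h b (Suc k). xi h k x = 0 \<or> xi h k x = i}"
    using coherent_down[OF cf, of k] coherent_restrict[OF cb f(1)] xf by auto
  then show ?thesis using f xf card_proj[OF cf, of k] block_end i by auto
qed

text \<open>Descend one level at a time, replacing \<open>b\<close> by the last element of a piece
  that contains \<open>y\<close>.\<close>

lemma full_sub:
  assumes c: "\<And>x. x \<le> b \<Longrightarrow> coherent h x" and "card (h b k) = m k" "y \<in> h b k" "l \<le> k"
  shows "\<exists>f\<in>h b k. y \<in> h f l \<and> card (h f l) = m l"
  using assms
proof (induction k arbitrary: b)
  case 0
  then show ?case using coherent_self[of h b 0] by auto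
next
  case (Suc k)
  have cb: "coherent h b" using Suc.prems(1) by simp
  show ?case
  proof (cases "l = Suc k")
    case True
    then show ?thesis using Suc.prems coherent_self[OF cb] by blast
  next
    case False
    \<comment> \<open>A root element has index 0 and lies in every piece; the first piece is chosen
      for it.\<close>
    define i where "i = max 1 (xi h k y)"
    have cy: "coherent h y" using Suc.prems(1,3) coherent_le[OF cb] by blast
    have "1 \<le> i" "i \<le> n (Suc k)" unfolding i_def
      using xi_le_n[OF cy] n_ge_2[of k] by auto
    then obtain f where f: "f \<in> h b (Suc k)" "card (h f k) = m k"
      "h f k = {x \<in> h b (Suc k). xi h k x = 0 \<or> xi h k x = i}"
      using full_block[OF Suc.prems(1,2)] by blast
    have "y \<in> h f k" unfolding f(3) i_def using Suc.prems(3) by auto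
    moreover have "\<And>x. x \<le> f \<Longrightarrow> coherent h x" using Suc.prems(1) coherent_le[OF cb f(1)] by (meson order_trans)
    moreover have "l \<le> k" using Suc.prems(4) False by simp
    ultimately obtain g where "g \<in> h f k" "y \<in> h g l \<and> card (h g l) = m l"
      using Suc.IH[of f] f(2) by blast
    moreover have "h f k \<subseteq> h b (Suc k)" unfolding f(3) by blast
    ultimately show ?thesis by blast
  qed
qed

text \<open>This is the coherence equation for a point placed right after \<open>z\<close> at levels
  \<open>k\<close> and \<open>Suc k\<close>, whose rank is one more than that of \<open>z\<close>.
  Outside the root, the piece of \<open>z\<close> has room and the new rank stays in its block; if
  \<open>z\<close> is in the root, so is all of its hull, and nothing is lost going down.\<close>

lemma follow_coherent:
  assumes z: "coherent h z" and nf: "card (h z k) < m k"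
  shows "h z k = {x \<in> h z (Suc k). xi h k x = 0 \<or> xi h k x = block k (Suc (card (h z (Suc k))))}"
proof (cases "xi h k z = 0")
  case False
  have "block k (Suc (card (h z (Suc k)))) = xi h k z"
    using block_Suc[of k "card (h z (Suc k))"] nf card_proj[OF z, of k] False by (simp add: xi_def)
  then show ?thesis using coherent_down[OF z, of k] by simp
next
  case True
  have "xi h k x = 0" if "x \<in> h z (Suc k)" for x
    using xi_mono[OF z that coherent_self[OF z] coherent_le[OF z that]] True by simp
  then show ?thesis using xi_le_1_down[OF z, of k] True by auto
qed

lemma follow_xi:
  assumes z: "coherent h z" and nf: "card (h z k) < m k" "xi h k z \<noteq> 0"
  shows "block k (Suc (card (h z (Suc k)))) = xi h k z"
  using block_Suc[of k "card (h z (Suc k))"] nf card_proj[OF z, of k] by (simp add: xi_def)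

text \<open>At level \<open>k + 1\<close> the root of a set containing \<open>a\<close> and \<open>b\<close> ends exactly at \<open>a\<close>, and \<open>b\<close> lies in the
  piece \<open>F\<^sub>0\<close>. A new point following \<open>a\<close> is free to choose its piece at such a level.\<close>

definition branches_off :: "('a::wellorder \<Rightarrow> nat \<Rightarrow> 'a set) \<Rightarrow> 'a \<Rightarrow> 'a \<Rightarrow> nat \<Rightarrow> bool" where
  "branches_off h a b k \<longleftrightarrow> a < b \<and> a \<in> h b k \<and> r (Suc k) = card (h a k) \<and> xi h k b = 1"

text \<open>As \<open>h z k\<close> is full and \<open>z\<close> lies in \<open>F\<^sub>0\<close>, a
  point following \<open>z\<close> at level \<open>Suc k\<close> opens the piece
  \<open>F\<^sub>1\<close>. Its level-\<open>k\<close> hull is then the root, which is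
  \<open>h x k\<close>, plus the point itself. So it may follow \<open>x\<close> at level
  \<open>k\<close> and \<open>z\<close> at level \<open>Suc k\<close>.\<close>

lemma jump_coherent:
  assumes z: "coherent h z" and j: "branches_off h x z k" and full: "card (h z k) = m k"
  shows "h x k = {u \<in> h z (Suc k). xi h k u = 0 \<or> xi h k u = block k (Suc (card (h z (Suc k))))}"
proof -
  have eq: "h z (Suc k) = h z k" using xi_le_1_down[OF z, of k] j by (simp add: branches_off_def)
  have "block k (Suc (m k)) = 2"
    using width_pos[of k] m_eq[of k] by (simp add: block_def)
  moreover have "xi h k u \<le> 1" if "u \<in> h z k" for u
    using xi_mono[OF z, of u k z] that eq coherent_self[OF z] coherent_le[OF z that] j by (simp add: branches_off_def)
  ultimately have "{u \<in> h z (Suc k). xi h k u = 0 \<or> xi h k u = block k (Suc (card (h z (Suc k))))}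
      = {u \<in> h z k. xi h k u = 0}"
    unfolding eq full by fastforce
  also have "\<dots> = {u \<in> h z k. u \<le> x}"
  proof -
    have x: "x \<in> h z k" "card (h x k) = r (Suc k)" using j by (auto simp: branches_off_def)
    have "h u (Suc k) = h u k" if "u \<in> h z k" for u
      using coherent_restrict[OF z, of u k] coherent_restrict[OF z, of u "Suc k"] that eq by simp
    then have "xi h k u = 0 \<longleftrightarrow> card (h u k) \<le> card (h x k)" if "u \<in> h z k" for u
      using that x by (simp add: xi_def block_eq_0)
    then show ?thesis using rank_less_iff[OF z x(1)] by (auto simp: not_less[symmetric])
  qed
  also have "\<dots> = h x k" using coherent_restrict[OF z, of x k] j by (auto simp: branches_off_def)
  finally show ?thesis by simp
qed

section \<open>Extending the hulls by a new top point\<close>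

definition top_ok :: "('a::wellorder \<Rightarrow> nat \<Rightarrow> 'a set) \<Rightarrow> 'a \<Rightarrow> nat \<Rightarrow> 'a set \<Rightarrow> bool" where
  "top_ok h b k B \<longleftrightarrow> b \<in> B \<and> finite B \<and> B \<subseteq> {..b} \<and> card B \<le> m k \<and>
     (\<forall>g\<in>B. g \<noteq> b \<longrightarrow> h g k = B \<inter> {..g})"

text \<open>The block of \<open>b\<close> is read off from \<open>card B\<close>, since
  \<open>B\<close> stands for a hull of \<open>b\<close> that \<open>h\<close> does not contain
  yet.\<close>

definition step_down :: "('a::wellorder \<Rightarrow> nat \<Rightarrow> 'a set) \<Rightarrow> 'a \<Rightarrow> nat \<Rightarrow> 'a set \<Rightarrow> 'a set" where
  "step_down h b k B = {x \<in> B. x = b \<or> xi h k x = 0 \<or> xi h k x = block k (card B)}"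

lemma top_ok_step_down:
  assumes c: "\<And>g. g < b \<Longrightarrow> coherent h g" and B: "top_ok h b (Suc k) B"
  shows "top_ok h b k (step_down h b k B)"
proof -
  \<comment> \<open>Entering \<open>B\<close> as the hull of \<open>b\<close> at this one level
    makes the rank and counting lemmas applicable to \<open>b\<close> as well.\<close>
  define h' where "h' = h(b := (h b)(Suc k := B))"
  have h': "h' x (Suc k) = (if x = b then B else h x (Suc k))" for x by (simp add: h'_def)
  have B': "top_ok h' b (Suc k) B" using B unfolding top_ok_def h' by simp
  have "xi h' k x = (if x = b then block k (card B) else xi h k x)" for x
    by (simp add: xi_def h')
  then have eq: "step_down h b k B = {x \<in> B. xi h' k x = 0 \<or> xi h' k x = block k (card B)}"
    unfolding step_down_def by auto
  have "bij_betw (\<lambda>x. card (h' x (Suc k))) B {1..card B}"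
    using B' by (intro rank_bij_restrict) (auto simp: top_ok_def h')
  then have card: "card (step_down h b k B) = proj k (card B)"
    unfolding eq by (rule card_down)
  have "h g k = step_down h b k B \<inter> {..g}" if g: "g \<in> step_down h b k B" "g \<noteq> b" for g
  proof -
    have gB: "g \<in> B" "xi h k g = 0 \<or> xi h k g = block k (card B)"
      using g by (auto simp: step_down_def)
    have gb: "g < b" using gB(1) g(2) B by (force simp: top_ok_def)
    have r1: "h g (Suc k) = B \<inter> {..g}" using B gB(1) g(2) by (simp add: top_ok_def)
    have cg: "coherent h g" using c gb by simp
    have "h g k = {x \<in> B \<inter> {..g}. xi h k x = 0 \<or> xi h k x = xi h k g}"
      using coherent_down[OF cg, of k] r1 by simp
    also have "\<dots> = {x \<in> B \<inter> {..g}. xi h k x = 0 \<or> xi h k x = block k (card B)}"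
    proof (cases "xi h k g = 0")
      case True
      have "xi h k x = 0" if "x \<in> B \<inter> {..g}" for x
      proof -
        have "x \<in> h g (Suc k)" using that r1 by simp
        then show ?thesis
          using xi_mono[OF cg _ coherent_self[OF cg]] coherent_le[OF cg] True by (metis le_zero_eq)
      qed
      then show ?thesis by blast
    next
      case False
      then show ?thesis using gB(2) by simp
    qed
    also have "\<dots> = step_down h b k B \<inter> {..g}"
      unfolding step_down_def using gb by auto
    finally show ?thesis .
  qed
  then show ?thesis using B card proj_le[of k "card B"]
    by (auto simp: top_ok_def step_down_def)
qed

lemma extend_down:
  assumes c: "\<And>g. g < b \<Longrightarrow> coherent h g" and "top_ok h b l B"
  shows "\<exists>f. f l = B \<and> (\<forall>k\<le>l. top_ok h b k (f k)) \<and> (\<forall>k<l. f k = step_down h b k (f (Suc k)))"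
  using assms(2)
proof (induction l arbitrary: B)
  case 0
  then show ?case by (intro exI[of _ "\<lambda>_. B"]) simp
next
  case (Suc l)
  have "top_ok h b l (step_down h b l B)" by (rule top_ok_step_down[OF c Suc.prems])
  from Suc.IH[OF this] obtain f where f: "f l = step_down h b l B" "\<forall>k\<le>l. top_ok h b k (f k)"
    "\<forall>k<l. f k = step_down h b k (f (Suc k))" by (elim exE conjE)
  let ?f = "f(Suc l := B)"
  have "top_ok h b k (?f k)" if "k \<le> Suc l" for k
    using that f(2) Suc.prems by (cases "k = Suc l") simp_all
  moreover have "?f k = step_down h b k (?f (Suc k))" if "k < Suc l" for k
  proof (cases "k = l")
    case True
    then show ?thesis using f(1) by simp
  next
    case False
    then have "k < l" using that by simp
    then show ?thesis using f(3)[rule_format, of k] by simp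
  qed
  ultimately show ?case by (intro exI[of _ ?f]) simp
qed

text \<open>It suffices to prescribe the hulls from level \<open>k0\<close> on: coherence forces the
  lower ones, which arise by repeated \<open>step_down\<close>. In \<open>coh\<close> the rank of
  \<open>b\<close> is one more than \<open>card (A (Suc k))\<close> because \<open>b\<close> itself
  is not in \<open>A\<close>.\<close>

lemma coherent_extend:
  assumes c: "\<And>g. g < b \<Longrightarrow> coherent h g"
    and fin: "\<And>k. k0 \<le> k \<Longrightarrow> finite (A k)" and sub: "\<And>k. k0 \<le> k \<Longrightarrow> A k \<subseteq> {..<b}"
    and card: "\<And>k. k0 \<le> k \<Longrightarrow> card (A k) < m k"
    and restr: "\<And>k g. k0 \<le> k \<Longrightarrow> g \<in> A k \<Longrightarrow> h g k = A k \<inter> {..g}"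
    and coh: "\<And>k. k0 \<le> k \<Longrightarrow>
      A k = {x \<in> A (Suc k). xi h k x = 0 \<or> xi h k x = block k (Suc (card (A (Suc k))))}"
    and cover: "\<And>g. g < b \<Longrightarrow> \<exists>k\<ge>k0. g \<in> A k"
  shows "\<exists>B. (\<forall>k\<ge>k0. B k = insert b (A k)) \<and> coherent (h(b := B)) b"
proof -
  have ok: "top_ok h b k (insert b (A k))" if "k0 \<le> k" for k
  proof -
    have "b \<notin> A k" using sub[OF that] by auto
    then have "card (insert b (A k)) \<le> m k" using card[OF that] fin[OF that] by simp
    moreover have "h g k = insert b (A k) \<inter> {..g}" if "g \<in> A k" for g
      using restr[OF \<open>k0 \<le> k\<close> that] sub[OF \<open>k0 \<le> k\<close>] that by auto
    ultimately show ?thesis using sub[OF that] fin[OF that] by (auto simp: top_ok_def)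
  qed
  have sd: "insert b (A k) = step_down h b k (insert b (A (Suc k)))" if "k0 \<le> k" for k
  proof -
    have *: "b \<notin> A (Suc k)" "finite (A (Suc k))" using sub[of "Suc k"] fin[of "Suc k"] that by auto
    show ?thesis unfolding step_down_def using coh[OF that] * by auto
  qed
  obtain f where f: "f k0 = insert b (A k0)" "\<forall>k\<le>k0. top_ok h b k (f k)"
    "\<forall>k<k0. f k = step_down h b k (f (Suc k))"
    using extend_down[OF c ok[of k0]] by auto
  define B where "B = (\<lambda>k. if k0 \<le> k then insert b (A k) else f k)"
  have okB: "top_ok h b k (B k)" for k using ok f(2) by (auto simp: B_def)
  have sdB: "B k = step_down h b k (B (Suc k))" for k
    using sd[of k] f(1,3) by (auto simp: B_def not_le Suc_le_eq dest!: le_antisym Suc_leI)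
  let ?h = "h(b := B)"
  have xi: "xi ?h k x = (if x = b then block k (card (B (Suc k))) else xi h k x)" for k x
    by (simp add: xi_def)
  have "coherent ?h b" unfolding coherent_def
  proof (intro conjI allI impI)
    fix k
    show "b \<in> ?h b k" "finite (?h b k)" "?h b k \<subseteq> {..b}" "card (?h b k) \<le> m k"
      using okB[of k] by (auto simp: top_ok_def)
    show "\<forall>g\<in>?h b k. ?h g k = ?h b k \<inter> {..g}"
      using okB[of k] by (auto simp: top_ok_def)
    show "?h b k = {x \<in> ?h b (Suc k). xi ?h k x = 0 \<or> xi ?h k x = xi ?h k b}"
      using sdB[of k] unfolding xi step_down_def by auto
  next
    fix g assume "g \<le> b"
    then show "\<exists>k. g \<in> ?h b k"
      using cover[of g] okB unfolding B_def top_ok_def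
      by (cases "g = b") (auto simp: less_le)
  qed
  then show ?thesis by (intro exI[of _ B]) (simp add: B_def)
qed

end

section \<open>Constructing the hulls\<close>

definition is_succ :: "'a::wellorder \<Rightarrow> 'a \<Rightarrow> bool" where
  "is_succ b c \<longleftrightarrow> b < c \<and> (\<forall>x. b < x \<longrightarrow> c \<le> x)"

lemma is_succ_exists: "b < c \<Longrightarrow> \<exists>b'. is_succ b b' \<and> b' \<le> c"
  by (intro exI[of _ "LEAST x. b < x"]) (auto simp: is_succ_def intro: LeastI Least_le)

lemma is_lim_or_succ:
  assumes "\<exists>b. b < d" "\<not> is_lim d"
  shows "\<exists>b. is_succ b d"
  using assms unfolding is_lim_def is_succ_def by (meson not_le)

lemma lim_succ_less: "is_lim d \<Longrightarrow> b < d \<Longrightarrow> \<exists>b'. is_succ b b' \<and> b' < d"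
  unfolding is_lim_def using is_succ_exists by (meson le_less_trans)

context scheme_type
begin

text \<open>The tuple \<open>t\<close> and the point \<open>e\<close> occupy the pieces \<open>F\<^sub>0, F\<^sub>1, \<dots>\<close> of one level-\<open>k + 1\<close> set whose root ends
  at \<open>y\<close>. The levels \<open>k0\<close> and \<open>k1\<close> allow a later point that currently follows \<open>x\<close> or some \<open>z \<in> Z\<close> to move
  to \<open>y\<close>, respectively past \<open>y\<close>, before level \<open>k + 1\<close> is reached; a point \<open>y\<close> can be reached exactly from a
  single \<open>x\<close> only.\<close>

definition catch :: "('a::wellorder \<Rightarrow> nat \<Rightarrow> 'a set) \<Rightarrow> 'a set list \<Rightarrow> 'a \<Rightarrow> 'a set \<Rightarrow> nat \<Rightarrow>
    'a \<Rightarrow> 'a \<Rightarrow> nat \<Rightarrow> nat \<Rightarrow> bool" where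
  "catch h t x Z K e y k0 k \<longleftrightarrow> K < k0 \<and> k0 < k \<and> branches_off h x y k0 \<and> card (h y k0) = m k0 \<and>
     (\<forall>z\<in>Z. \<exists>k1. k0 < k1 \<and> k1 < k \<and> branches_off h z y k1) \<and>
     y < e \<and> y \<in> h e k \<and> r (Suc k) = card (h y k) \<and> xi h k e = Suc (length t) \<and>
     (\<forall>i<length t. \<forall>v\<in>t ! i. v \<le> e \<and> v \<in> h e (Suc k) \<and> xi h k v = Suc i)"

text \<open>The quantifiers make the property usable over and over: \<open>x\<close> and
  \<open>Z\<close> stand for points that a later construction may be following, and \<open>K\<close>
  bounds the levels already spent.\<close>

definition caught_below :: "('a::wellorder \<Rightarrow> nat \<Rightarrow> 'a set) \<Rightarrow> 'a set list set \<Rightarrow> 'a \<Rightarrow> bool" where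
  "caught_below h T d \<longleftrightarrow> (\<forall>x<d. \<forall>Z K. finite Z \<and> Z \<subseteq> {..<d} \<longrightarrow>
     (\<exists>t\<in>T. \<exists>e<d. \<exists>y k0 k. catch h t x Z K e y k0 k))"

definition caught_at :: "('a::wellorder \<Rightarrow> nat \<Rightarrow> 'a set) \<Rightarrow> 'a set list set \<Rightarrow> 'a \<Rightarrow> bool" where
  "caught_at h T d \<longleftrightarrow> (\<forall>x<d. \<forall>Z K. finite Z \<and> Z \<subseteq> {..<d} \<longrightarrow>
     (\<exists>t\<in>T. \<exists>y k0 k. catch h t x Z K d y k0 k))"

text \<open>The invariant of the recursion. The offset \<open>j\<close> is there for successors,
  whose hulls gain one element; \<open>j = 0\<close> gives roots that end exactly at
  \<open>d\<close>. The last clause makes limits catch what is caught below them, where the tuple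
  sets \<open>T s d\<close> are fixed before the recursion starts.\<close>

definition hull_ok :: "(nat \<Rightarrow> 'a::wellorder \<Rightarrow> 'a set list set) \<Rightarrow>
    ('a \<Rightarrow> nat \<Rightarrow> 'a set) \<Rightarrow> 'a \<Rightarrow> bool" where
  "hull_ok T h d \<longleftrightarrow> coherent h d \<and>
     (\<forall>j K. \<exists>k>K. r (Suc k) = card (h d k) + j) \<and>
     (\<forall>a<d. \<forall>K. \<exists>k>K. branches_off h a d k) \<and>
     (\<forall>b k. is_succ b d \<and> card (h b k) < m k \<longrightarrow> h d k = insert d (h b k)) \<and>
     (\<forall>s. is_lim d \<and> caught_below h (T s d) d \<longrightarrow> caught_at h (T s d) d)"

lemma
  assumes "hull_ok T h d"
  shows hull_coherent: "coherent h d"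
    and hull_root: "\<exists>k>K. r (Suc k) = card (h d k) + j"
    and hull_branches_off: "a < d \<Longrightarrow> \<exists>k>K. branches_off h a d k"
    and hull_succ: "is_succ b d \<Longrightarrow> card (h b k) < m k \<Longrightarrow> h d k = insert d (h b k)"
    and hull_lim: "is_lim d \<Longrightarrow> caught_below h (T s d) d \<Longrightarrow> caught_at h (T s d) d"
  using assms unfolding hull_ok_def by blast+

section \<open>The conditions at a point depend only on the hulls up to that point\<close>

lemma xi_cong: "f x = g x \<Longrightarrow> xi f k x = xi g k x"
  by (simp add: xi_def)

lemma coherent_cong:
  assumes eq: "\<And>y. y \<le> x \<Longrightarrow> f y = g y" and c: "coherent f x"
  shows "coherent g x"
proof -
  have fx: "f x = g x" using eq by simp
  have le: "y \<le> x" if "y \<in> g x k" for y k using coherent_le[OF c] that fx by simp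
  have xi: "xi g k y = xi f k y" if "y \<le> x" for y k using xi_cong eq that by metis
  show ?thesis unfolding coherent_def
  proof (intro conjI allI impI ballI)
    fix k
    show "x \<in> g x k" "finite (g x k)" "g x k \<subseteq> {..x}" "card (g x k) \<le> m k"
      using coherent_self[OF c] coherent_finite[OF c] coherent_card[OF c] le fx by auto
    show "g y k = g x k \<inter> {..y}" if "y \<in> g x k" for y
      using coherent_restrict[OF c, of y k] eq[OF le[OF that]] fx that by simp
    show "g x k = {y \<in> g x (Suc k). xi g k y = 0 \<or> xi g k y = xi g k x}"
      using coherent_down[OF c, of k] xi le[of _ "Suc k"] unfolding fx by auto
  next
    fix y assume "y \<le> x"
    then show "\<exists>k. y \<in> g x k" using coherent_cover[OF c] fx by simp
  qed
qed

lemma branches_off_cong: "(\<And>y. y \<le> b \<Longrightarrow> f y = g y) \<Longrightarrow> branches_off f a b k = branches_off g a b k"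
  unfolding branches_off_def xi_def by (cases "a < b") auto

lemma catch_cong:
  assumes eq: "\<And>y. y \<le> e \<Longrightarrow> f y = g y" and c: "catch f t x Z K e y k0 k"
  shows "catch g t x Z K e y k0 k"
proof -
  have y: "y < e" using c by (simp add: catch_def)
  have "branches_off f a y l = branches_off g a y l" for a l by (rule branches_off_cong) (use y eq in auto)
  moreover have "f y = g y" "f e = g e" using y eq by auto
  moreover have "xi f l v = xi g l v" if "v \<le> e" for v l using eq[OF that] xi_cong by metis
  ultimately show ?thesis using c unfolding catch_def by (simp, metis)
qed

lemma caught_below_cong:
  assumes eq: "\<And>y. y < d \<Longrightarrow> f y = g y" and c: "caught_below f T d"
  shows "caught_below g T d"
  unfolding caught_below_def
proof (intro allI impI)
  fix x Z K assume "x < d" "finite Z \<and> Z \<subseteq> {..<d}"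
  from c[unfolded caught_below_def, rule_format, OF this, of K]
  obtain t e y k0 k where *: "t \<in> T" "e < d" "catch f t x Z K e y k0 k" by blast
  have "catch g t x Z K e y k0 k" by (rule catch_cong[of e f g]) (use eq * in auto)
  with * show "\<exists>t\<in>T. \<exists>e<d. \<exists>y k0 k. catch g t x Z K e y k0 k" by blast
qed

lemma caught_at_cong:
  assumes eq: "\<And>y. y \<le> d \<Longrightarrow> f y = g y" and c: "caught_at f T d"
  shows "caught_at g T d"
  unfolding caught_at_def
proof (intro allI impI)
  fix x Z K assume "x < d" "finite Z \<and> Z \<subseteq> {..<d}"
  from c[unfolded caught_at_def, rule_format, OF this, of K]
  obtain t y k0 k where *: "t \<in> T" "catch f t x Z K d y k0 k" by blast
  have "catch g t x Z K d y k0 k" by (rule catch_cong[of d f g]) (use eq * in auto)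
  with * show "\<exists>t\<in>T. \<exists>y k0 k. catch g t x Z K d y k0 k" by blast
qed

lemma hull_ok_cong:
  assumes eq: "\<And>y. y \<le> d \<Longrightarrow> f y = g y" and c: "hull_ok T f d"
  shows "hull_ok T g d"
  unfolding hull_ok_def
proof (intro conjI allI impI)
  have fd: "f d = g d" using eq by simp
  show "coherent g d" by (rule coherent_cong[of d f g]) (use eq hull_coherent[OF c] in auto)
  show "\<exists>k>K. r (Suc k) = card (g d k) + j" for j K using hull_root[OF c] fd by simp
  show "\<exists>k>K. branches_off g a d k" if "a < d" for a K
    using hull_branches_off[OF c that] branches_off_cong[of d f g, OF eq] by blast
  show "g d k = insert d (g b k)" if "is_succ b d \<and> card (g b k) < m k" for b k
  proof -
    have "f b = g b" using eq that by (auto simp: is_succ_def)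
    then show ?thesis using hull_succ[OF c, of b k] that fd by simp
  qed
  show "caught_at g (T s d) d" if "is_lim d \<and> caught_below g (T s d) d" for s
  proof -
    have "caught_below f (T s d) d"
      by (rule caught_below_cong[of d g f]) (use eq that in auto)
    then have "caught_at f (T s d) d" using hull_lim[OF c] that by blast
    then show ?thesis using caught_at_cong[of d f g] eq by blast
  qed
qed

text \<open>A top point \<open>d\<close> that follows \<open>z\<close> at levels \<open>k\<close>
  and \<open>Suc k\<close> falls into the block of \<open>z\<close>, whose piece has room, provided
  \<open>z\<close> is outside the root. Thus \<open>d\<close> takes over what \<open>z\<close>
  achieves at level \<open>k\<close>.\<close>

lemma
  assumes z: "coherent h z" "z < d" and nf: "card (h z k) < m k"
    and h': "h' = h(d := B)" and B: "B k = insert d (h z k)" "B (Suc k) = insert d (h z (Suc k))"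
  shows follow_top_branches_off: "branches_off h a z k \<Longrightarrow> branches_off h' a d k"
    and follow_top_catch: "catch h t x Z K z y k0 k \<Longrightarrow> catch h' t x Z K d y k0 k"
proof -
  have "d \<notin> h z (Suc k)" using coherent_le[OF z(1)] z(2) by force
  then have card: "card (h' d (Suc k)) = Suc (card (h z (Suc k)))"
    using B coherent_finite[OF z(1)] h' by simp
  have xi: "xi h k z \<noteq> 0 \<Longrightarrow> xi h' k d = xi h k z"
    using follow_xi[OF z(1) nf] card by (simp add: xi_def)
  show "branches_off h' a d k" if "branches_off h a z k"
    using that xi z(2) B h' unfolding branches_off_def by auto
  show "catch h' t x Z K d y k0 k" if c: "catch h t x Z K z y k0 k"
  proof -
    have y: "y < z" using c by (simp add: catch_def)
    have "branches_off h a y l = branches_off h' a y l" for a l by (rule branches_off_cong) (use y z(2) h' in auto)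
    moreover have "h' y = h y" using y z h' by auto
    moreover have "xi h' l v = xi h l v" if "v \<le> z" for v l
      by (rule xi_cong) (use that z(2) h' in auto)
    moreover have "xi h k z \<noteq> 0" using c by (simp add: catch_def)
    moreover have "y < d" using y z by simp
    moreover have "v \<le> d" if "v \<le> z" for v using that z(2) by simp
    moreover have "h' d k = insert d (h z k)" "h' d (Suc k) = insert d (h z (Suc k))" using B h' by auto
    ultimately show ?thesis using c xi unfolding catch_def by auto
  qed
qed

text \<open>A successor follows its predecessor while the hull of the latter is not full, so each
  successor step adds one element to the level-\<open>k\<close> hull until it has \<open>m k\<close>
  elements.\<close>

lemma full_exists:
  assumes ok: "\<And>x. x \<in> D \<Longrightarrow> hull_ok T h x" and succ: "\<And>x. x \<in> D \<Longrightarrow> \<exists>x'\<in>D. is_succ x x'"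
    and "y \<in> D"
  shows "\<exists>z\<in>D. y \<in> h z k \<and> card (h z k) = m k"
  using \<open>y \<in> D\<close>
proof (induction "m k - card (h y k)" arbitrary: y rule: less_induct)
  case less
  have c: "coherent h y" using hull_coherent ok less.prems by blast
  show ?case
  proof (cases "card (h y k) = m k")
    case True
    then show ?thesis using less.prems coherent_self[OF c] by blast
  next
    case False
    then have nf: "card (h y k) < m k" using coherent_card[OF c, of k] by simp
    obtain y' where y': "y' \<in> D" "is_succ y y'" using succ less.prems by blast
    have h: "h y' k = insert y' (h y k)" using hull_succ[OF ok[OF y'(1)] y'(2) nf] .
    have "y' \<notin> h y k" using coherent_le[OF c] y'(2) by (force simp: is_succ_def)
    then have "card (h y' k) = Suc (card (h y k))" using h coherent_finite[OF c] by simp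
    then obtain z where z: "z \<in> D" "y' \<in> h z k" "card (h z k) = m k"
      using less.hyps[of y'] y'(1) nf by (metis diff_less_mono2 lessI)
    have "y \<in> h y' k" using h coherent_self[OF c] by simp
    then have "y \<in> h z k" using coherent_sub[OF hull_coherent[OF ok[OF z(1)]] z(2)] by blast
    then show ?thesis using z by blast
  qed
qed

lemma eventually_mem:
  assumes "coherent h b" "g \<le> b"
  shows "\<exists>K. \<forall>k\<ge>K. g \<in> h b k"
  using coherent_cover[OF assms] coherent_mono[OF assms(1)] by blast

end

lemma finite_bound:
  assumes "finite Z" "\<And>z. z \<in> Z \<Longrightarrow> \<exists>k::nat. P z k"
  shows "\<exists>L. \<forall>z\<in>Z. \<exists>k<L. P z k"
proof -
  obtain f where f: "\<And>z. z \<in> Z \<Longrightarrow> P z (f z)" using assms(2) by metis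
  have "f z < Suc (Max (f ` Z))" if "z \<in> Z" for z
    using assms(1) that by (simp add: less_Suc_eq_le)
  then show ?thesis using f by blast
qed

context scheme_type
begin

section \<open>Branching off and catches below a limit\<close>

lemma branches_off_upward:
  assumes y: "coherent h y" "b \<in> h y k" and j: "branches_off h x b k"
  shows "branches_off h x y k"
proof -
  have "x \<in> h y k" using coherent_sub[OF y] j by (auto simp: branches_off_def)
  moreover have "xi h k y = 1" using coherent_xi[OF y] j by (simp add: branches_off_def)
  moreover have "x < y" using coherent_le[OF y] j by (auto simp: branches_off_def)
  ultimately show ?thesis using j by (simp add: branches_off_def)
qed

lemma full_exists_below:
  assumes lim: "is_lim d" and ok: "\<And>x. x < d \<Longrightarrow> hull_ok T h x" and "y < d"
  shows "\<exists>z<d. y \<in> h z k \<and> card (h z k) = m k"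
proof -
  have "\<exists>z\<in>{..<d}. y \<in> h z k \<and> card (h z k) = m k"
    by (rule full_exists[of _ T]) (use ok lim_succ_less[OF lim] \<open>y < d\<close> in auto)
  then show ?thesis by auto
qed

text \<open>With no tuple to catch, \<open>e\<close> only has to lie in \<open>F\<^sub>0\<close>
  over a root ending at \<open>y\<close>, which the successor of \<open>y\<close> does at
  arbitrarily high levels. The point \<open>y\<close> is the top of a full hull at a level where
  \<open>x\<close> is branched off.\<close>

lemma caught_below_Nil:
  assumes lim: "is_lim d" and ok: "\<And>x. x < d \<Longrightarrow> hull_ok T h x"
  shows "caught_below h {[]} d"
  unfolding caught_below_def
proof (intro allI impI)
  fix x Z K assume x: "x < d" and Z: "finite Z \<and> Z \<subseteq> {..<d}"
  define c where "c = Max (insert x Z)"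
  have c: "c < d" "x \<le> c" "\<And>z. z \<in> Z \<Longrightarrow> z \<le> c" using x Z unfolding c_def by auto
  obtain b where b: "is_succ c b" "b < d" using lim_succ_less[OF lim c(1)] by blast
  have cb: "c < b" using b by (simp add: is_succ_def)
  obtain k0 where k0: "k0 > K" "branches_off h x b k0" using hull_branches_off[OF ok[OF b(2)] le_less_trans[OF c(2) cb]] by blast
  obtain y where y: "y < d" "b \<in> h y k0" "card (h y k0) = m k0"
    using full_exists_below[OF lim ok b(2)] by blast
  have cy: "coherent h y" using hull_coherent ok y(1) by blast
  have J0: "branches_off h x y k0" using branches_off_upward[OF cy y(2) k0(2)] .
  have "c < y" using cb coherent_le[OF cy y(2)] by simp
  then have "\<exists>k1. k0 < k1 \<and> branches_off h z y k1" if "z \<in> Z" for z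
    using hull_branches_off[OF ok[OF y(1)]] c(3)[OF that] le_less_trans by blast
  then obtain L where L: "\<forall>z\<in>Z. \<exists>k1<L. k0 < k1 \<and> branches_off h z y k1"
    using finite_bound[of Z "\<lambda>z k1. k0 < k1 \<and> branches_off h z y k1"] Z by auto
  obtain e where e: "is_succ y e" "e < d" using lim_succ_less[OF lim y(1)] by blast
  have "y < e" using e(1) by (simp add: is_succ_def)
  then obtain k where k: "k > max k0 L" "branches_off h y e k" using hull_branches_off[OF ok[OF e(2)]] by blast
  have "\<exists>k1. k0 < k1 \<and> k1 < k \<and> branches_off h z y k1" if "z \<in> Z" for z
    using L[rule_format, OF that] k(1) by auto
  then have "catch h [] x Z K e y k0 k"
    using k0(1) k J0 y(3) unfolding catch_def by (simp add: branches_off_def)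
  then show "\<exists>t\<in>{[]}. \<exists>e<d. \<exists>y k0 k. catch h t x Z K e y k0 k" using e(2) by blast
qed

text \<open>One step of the limit construction: the new point stops following \<open>z\<close> and follows \<open>z'\<close>, which lies in
  the piece next to the caught tuple \<open>t\<close>; hence so will the new point.\<close>

lemma jump_exists:
  assumes lim: "is_lim d" and ok: "\<And>x. x < d \<Longrightarrow> hull_ok T h x"
    and V: "caught_below h T' d" and x: "x < d" and Z: "finite Z" "Z \<subseteq> {..<d}" and z: "z < d"
  shows "\<exists>t\<in>T'. \<exists>z'<d. \<exists>y k0 k k1. catch h t x Z K z' y k0 k \<and> N < k1 \<and> k1 < k \<and>
           branches_off h z z' k1 \<and> card (h z' k1) = m k1"
proof -
  \<comment> \<open>Adding \<open>z\<close> to \<open>Z\<close> makes the catch supply a level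
    \<open>k1\<close> between \<open>k0\<close> and \<open>k\<close> with
    \<open>branches_off h z y k1\<close>, where the new point can leave \<open>z\<close>.\<close>
  have "finite (insert z Z) \<and> insert z Z \<subseteq> {..<d}" using Z z by simp
  from V[unfolded caught_below_def, rule_format, OF x this, of "max K N"]
  obtain t e y k0 k where t: "t \<in> T'" and e: "e < d"
    and c: "catch h t x (insert z Z) (max K N) e y k0 k" by blast
  have y: "y < e" "y \<in> h e k" "r (Suc k) = card (h y k)" "branches_off h x y k0" "card (h y k0) = m k0"
    and k0: "max K N < k0" "k0 < k"
    and xe: "xi h k e = Suc (length t)"
    using c by (auto simp: catch_def)
  obtain k1 where k1: "k0 < k1" "k1 < k" "branches_off h z y k1" using c by (auto simp: catch_def)
  obtain e' where e': "e' < d" "e \<in> h e' k" "card (h e' k) = m k"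
    using full_exists_below[OF lim ok e] by blast
  have coherent: "\<And>u. u < d \<Longrightarrow> coherent h u" using hull_coherent ok by blast
  have cy: "coherent h y" and ce': "coherent h e'" using coherent y(1) e e'(1) by auto
  have "y \<in> h e' k" using coherent_sub[OF ce' e'(2)] y(2) by blast
  moreover have "\<And>u. u \<le> e' \<Longrightarrow> coherent h u" using coherent e'(1) by auto
  \<comment> \<open>The full level-\<open>k1\<close> hull around \<open>y\<close> is taken inside
    the full level-\<open>k\<close> hull of \<open>e'\<close>. This keeps \<open>z'\<close> in the
    piece of \<open>e\<close>, so that \<open>z'\<close> can replace \<open>e\<close> in the
    catch.\<close>
  ultimately obtain z' where z': "z' \<in> h e' k" "y \<in> h z' k1" "card (h z' k1) = m k1"
    using full_sub[of e' h k y k1] e'(3) k1(2) by auto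
  have z'e: "z' \<le> e'" using coherent_le[OF ce' z'(1)] .
  then have z'd: "z' < d" using e'(1) by simp
  then have cz': "coherent h z'" using coherent by blast
  \<comment> \<open>The hull of \<open>y\<close> is full at level \<open>k0\<close> and does not
    grow at the next one, so from then on it has room. Hence \<open>y\<close> is not
    \<open>z'\<close>, whose hull is full at level \<open>k1\<close>, and \<open>z'\<close> lies
    beyond the root.\<close>
  have "h y (Suc k0) = h y k0" using xi_le_1_down[OF cy, of k0] y(4) by (simp add: branches_off_def)
  then have "card (h y (Suc k0)) < m (Suc k0)" using y(5) m_less_Suc by simp
  then have "card (h y k1) < m k1" using not_full_mono[OF cy] k1(1) by (simp add: Suc_le_eq)
  then have yz': "y < z'" using coherent_le[OF cz' z'(2)] z'(3) by (cases "y = z'") auto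
  have Jz: "branches_off h z z' k1" using branches_off_upward[OF cz' z'(2) k1(3)] .
  have yk: "y \<in> h z' k" using z'(2) coherent_mono[OF cz', of k1 k] k1(2) by auto
  have xe': "xi h k e' = Suc (length t)" using coherent_xi[OF ce' e'(2)] xe by simp
  have "card (h y k) < card (h z' k)" using rank_less[OF cz' yk coherent_self[OF cz'] yz'] .
  then have "xi h k z' \<noteq> 0" using xi_eq_0[OF cz'] y(3) by simp
  then have xz': "xi h k z' = Suc (length t)" using coherent_xi[OF ce' z'(1)] xe' by simp
  have sub: "h e' k \<subseteq> h e' (Suc k)" using coherent_mono[OF ce'] by simp
  have "v \<le> z' \<and> v \<in> h z' (Suc k) \<and> xi h k v = Suc i" if "i < length t" "v \<in> t ! i" for i v
  proof -
    have v: "v \<in> h e (Suc k)" "xi h k v = Suc i" using c that by (auto simp: catch_def)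
    have v': "v \<in> h e' (Suc k)" using coherent_sub[OF ce', of e "Suc k"] sub e'(2) v(1) by blast
    have "v \<le> z'"
    proof (rule ccontr)
      assume "\<not> v \<le> z'"
      then have "xi h k z' \<le> xi h k v" using xi_mono[OF ce' _ v'] z'(1) sub by auto
      then show False using xz' v(2) that by simp
    qed
    then show ?thesis using coherent_restrict[OF ce', of z' "Suc k"] z'(1) sub v' v(2) by auto
  qed
  then have "catch h t x Z K z' y k0 k"
    using c yz' yk xz' unfolding catch_def by auto
  moreover have "N < k1" using k0(1) k1(1) by simp
  ultimately show ?thesis using t z'd k1(2) Jz z'(3) by blast
qed

text \<open>The point \<open>d\<close> follows \<open>b\<close> wherever the hull of
  \<open>b\<close> has room, and so inherits from \<open>b\<close> the levels it needs.\<close>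

lemma hull_ok_successor:
  assumes b: "is_succ b d" and ok: "\<And>x. x < d \<Longrightarrow> hull_ok T h x"
  shows "\<exists>B. hull_ok T (h(d := B)) d"
proof -
  have bd: "b < d" using b by (simp add: is_succ_def)
  have okb: "hull_ok T h b" using ok bd by blast
  have cb: "coherent h b" using hull_coherent[OF okb] .
  have coherent: "\<And>u. u < d \<Longrightarrow> coherent h u" using hull_coherent ok by blast
  \<comment> \<open>The least such level is taken because the successor clause covers every level at
    which the hull of \<open>b\<close> is not full.\<close>
  define k0 where "k0 = (LEAST k. card (h b k) < m k)"
  obtain k' where "r (Suc k') = card (h b k') + 0" using hull_root[OF okb] by blast
  then have "card (h b k') < m k'" using r_less_m[of k'] by simp
  then have "card (h b k0) < m k0" unfolding k0_def by (rule LeastI)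
  then have nf: "card (h b k) < m k" if "k0 \<le> k" for k using not_full_mono[OF cb] that by blast
  have le: "g \<le> b" if "g < d" for g using b that unfolding is_succ_def by (meson not_le)
  have "\<exists>B. (\<forall>k\<ge>k0. B k = insert d (h b k)) \<and> coherent (h(d := B)) d"
  proof (rule coherent_extend)
    show "h b k \<subseteq> {..<d}" for k using coherent_le[OF cb] bd by fastforce
    show "\<exists>k\<ge>k0. g \<in> h b k" if "g < d" for g
      using eventually_mem[OF cb le[OF that]] by (meson nat_le_linear)
  qed (use coherent coherent_finite[OF cb] nf coherent_restrict[OF cb] follow_coherent[OF cb] in auto)
  then obtain B where B: "\<And>k. k0 \<le> k \<Longrightarrow> B k = insert d (h b k)" "coherent (h(d := B)) d" by blast
  let ?h = "h(d := B)"
  have lift: "branches_off ?h a d k" if "branches_off h a b k" "k0 \<le> k" for a k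
    by (rule follow_top_branches_off[OF cb bd nf refl B(1) B(1)]) (use that in auto)
  have dn: "d \<notin> h b k" for k using coherent_le[OF cb] bd by force
  have "hull_ok T ?h d" unfolding hull_ok_def
  proof (intro conjI allI impI)
    show "coherent ?h d" by (rule B(2))
    show "\<exists>k>K. r (Suc k) = card (?h d k) + j" for j K
    proof -
      obtain k where "k > max K k0" "r (Suc k) = card (h b k) + Suc j" using hull_root[OF okb] by blast
      then show ?thesis using B(1)[of k] dn[of k] coherent_finite[OF cb, of k] by (intro exI[of _ k]) simp
    qed
    show "\<exists>k>K. branches_off ?h a d k" if "a < d" for a K
    proof (cases "a = b")
      case False
      then have "a < b" using le[OF \<open>a < d\<close>] by simp
      then obtain k where "k > max K k0" "branches_off h a b k" using hull_branches_off[OF okb] by blast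
      then show ?thesis using lift[of a k] by (intro exI[of _ k]) simp
    next
      case True
      \<comment> \<open>A root that ends exactly at \<open>b\<close> leaves the next rank, the first
        place of \<open>F\<^sub>0\<close>, to \<open>d\<close>.\<close>
      obtain k where k: "k > max K k0" "r (Suc k) = card (h b k) + 0" using hull_root[OF okb] by blast
      have "xi h k b = 0" using xi_eq_0[OF cb] k(2) by simp
      then have eq: "h b (Suc k) = h b k" using xi_le_1_down[OF cb] by simp
      have "card (?h d (Suc k)) = Suc (r (Suc k))"
        using B(1)[of "Suc k"] dn[of "Suc k"] coherent_finite[OF cb, of k] k eq by simp
      then have "xi ?h k d = 1" by (simp add: xi_def block_Suc_root del: fun_upd_apply)
      moreover have "b \<in> ?h d k" using B(1)[of k] k(1) coherent_self[OF cb] by simp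
      ultimately have "branches_off ?h b d k" using bd k(2) by (simp add: branches_off_def)
      then show ?thesis using True k(1) by auto
    qed
    show "?h d k = insert d (?h b' k)" if "is_succ b' d \<and> card (?h b' k) < m k" for b' k
    proof -
      have "b' = b" using that b unfolding is_succ_def by (meson antisym_conv3 leD)
      then have "k0 \<le> k" using that bd unfolding k0_def by (intro Least_le) (auto split: if_splits)
      then show ?thesis using B(1) \<open>b' = b\<close> bd by simp
    qed
    show "caught_at ?h (T s d) d" if "is_lim d \<and> caught_below ?h (T s d) d" for s
    proof -
      have "is_lim d" using that by simp
      then obtain c where c: "b < c" "c < d" using bd unfolding is_lim_def by blast
      then have "d \<le> c" using b by (simp add: is_succ_def)
      then show ?thesis using c(2) by simp
    qed
  qed
  then show ?thesis by blast
qed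

lemma hull_ok_least:
  assumes "\<And>x. \<not> x < d"
  shows "\<exists>B. hull_ok T (h(d := B)) d"
proof -
  have "\<exists>B. (\<forall>k\<ge>0. B k = insert d {}) \<and> coherent (h(d := B)) d"
    by (rule coherent_extend[where A = "\<lambda>_. {}"]) (use assms m_pos in auto)
  then obtain B where B: "\<And>k. B k = {d}" "coherent (h(d := B)) d" by auto
  have "hull_ok T (h(d := B)) d" unfolding hull_ok_def
  proof (intro conjI allI impI)
    show "\<exists>k>K. r (Suc k) = card ((h(d := B)) d k) + j" for j K
      using r_infinitely_often[of K "Suc j"] B(1) by simp
  qed (use B assms in \<open>auto simp: is_succ_def is_lim_def\<close>)
  then show ?thesis by blast
qed

end

section \<open>The limit step\<close>

lemma enumerate_tasks:
  fixes d :: "'a::wellorder"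
  assumes "x0 < d" "countable {..<d}"
  shows "\<exists>(ts :: nat \<Rightarrow> nat) tx tZ (tK :: nat \<Rightarrow> nat).
    (\<forall>i. tx i < d \<and> finite (tZ i) \<and> tZ i \<subseteq> {..<d}) \<and>
    (\<forall>s x Z K. x < d \<and> finite Z \<and> Z \<subseteq> {..<d} \<longrightarrow>
      (\<exists>i. ts i = s \<and> tx i = x \<and> tZ i = Z \<and> tK i = K))"
proof -
  define A :: "(nat \<times> 'a \<times> 'a set \<times> nat) set" where
    "A = UNIV \<times> {..<d} \<times> {Z. finite Z \<and> Z \<subseteq> {..<d}} \<times> UNIV"
  have A: "countable A" unfolding A_def
    using assms(2) countable_Collect_finite_subset[OF assms(2)] by (intro countable_SIGMA) auto
  have ne: "A \<noteq> {}" unfolding A_def using assms(1) by auto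
  let ?f = "from_nat_into A"
  have mem: "(s, x, Z, K) \<in> A \<longleftrightarrow> x < d \<and> finite Z \<and> Z \<subseteq> {..<d}" for s x Z K
    unfolding A_def by simp
  have 1: "fst (snd (?f i)) < d \<and> finite (fst (snd (snd (?f i)))) \<and> fst (snd (snd (?f i))) \<subseteq> {..<d}" for i
    using from_nat_into[OF ne, of i] mem by (cases "?f i") auto
  have 2: "\<exists>i. ?f i = (s, x, Z, K)" if "x < d \<and> finite Z \<and> Z \<subseteq> {..<d}" for s x Z K
    using from_nat_into_surj[OF A, of "(s, x, Z, K)"] that mem by simp
  have 3: "\<exists>i. fst (?f i) = s \<and> fst (snd (?f i)) = x \<and> fst (snd (snd (?f i))) = Z \<and>
      snd (snd (snd (?f i))) = K" if "x < d \<and> finite Z \<and> Z \<subseteq> {..<d}" for s x Z K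
  proof -
    obtain i where "?f i = (s, x, Z, K)" using 2[OF \<open>x < d \<and> finite Z \<and> Z \<subseteq> {..<d}\<close>] by blast
    then show ?thesis by (intro exI[of _ i]) simp
  qed
  show ?thesis
    by (rule exI[of _ "\<lambda>i. fst (?f i)"], rule exI[of _ "\<lambda>i. fst (snd (?f i))"],
        rule exI[of _ "\<lambda>i. fst (snd (snd (?f i)))"], rule exI[of _ "\<lambda>i. snd (snd (snd (?f i)))"])
      (intro conjI[OF allI[OF 1]] allI impI 3, simp_all)
qed

context scheme_type
begin

text \<open>The new point \<open>d\<close> will follow \<open>z i\<close> at the levels from
  \<open>l i\<close> to below \<open>l (Suc i)\<close>. What task \<open>i\<close> asks for happens
  between \<open>l (Suc i)\<close> and \<open>u (Suc i)\<close>, and the next jump is postponed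
  beyond \<open>u (Suc i)\<close>, so that \<open>d\<close> still follows \<open>z (Suc i)\<close>
  then.\<close>

lemma jump_sequence:
  fixes tx :: "nat \<Rightarrow> 'a::wellorder" and tK :: "nat \<Rightarrow> nat"
  assumes lim: "is_lim d" and all_ok: "\<forall>x<d. hull_ok T h x"
    and V: "\<And>i. caught_below h (T' i) d"
    and tx: "\<And>i. tx i < d" and tZ: "\<And>i. finite (tZ i)" "\<And>i. tZ i \<subseteq> {..<d}"
  shows "\<exists>z l u. \<forall>i. z i < d \<and> l i \<le> u i \<and> card (h (z i) (l i)) < m (l i) \<and>
     (\<exists>k1. l (Suc i) = Suc k1 \<and> u i < k1 \<and> branches_off h (z i) (z (Suc i)) k1 \<and> card (h (z (Suc i)) k1) = m k1) \<and>
     (\<exists>t\<in>T' i. \<exists>y k0 k. catch h t (tx i) (tZ i) (tK i) (z (Suc i)) y k0 k \<and>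
        l (Suc i) \<le> k \<and> k < u (Suc i)) \<and>
     (\<forall>a\<in>tZ i. \<exists>k>tK i. l (Suc i) \<le> k \<and> k < u (Suc i) \<and> branches_off h a (z (Suc i)) k) \<and>
     (\<exists>k>tK i. l (Suc i) \<le> k \<and> k < u (Suc i) \<and> r (Suc k) = card (h (z (Suc i)) k) + Suc (ts i))"
proof -
  note ok = all_ok[rule_format]
  define P where "P = (\<lambda>(i::nat) (z, l, u). z < d \<and> l \<le> u \<and> card (h z l) < m l)"
  define Q where "Q = (\<lambda>(i::nat) (z, l::nat, u::nat) (z', l', u').
     (\<exists>k1. l' = Suc k1 \<and> u < k1 \<and> branches_off h z z' k1 \<and> card (h z' k1) = m k1) \<and>
     (\<exists>t\<in>T' i. \<exists>y k0 k. catch h t (tx i) (tZ i) (tK i) z' y k0 k \<and> l' \<le> k \<and> k < u') \<and>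
     (\<forall>a\<in>tZ i. \<exists>k>tK i. l' \<le> k \<and> k < u' \<and> branches_off h a z' k) \<and>
     (\<exists>k>tK i. l' \<le> k \<and> k < u' \<and> r (Suc k) = card (h z' k) + Suc (ts i)))"
  have coherent: "\<And>u. u < d \<Longrightarrow> coherent h u" using hull_coherent ok by blast
  have "\<exists>f. \<forall>i. P i (f i) \<and> Q i (f i) (f (Suc i))"
  proof (rule dependent_nat_choice)
    obtain z where z: "z < d" using lim unfolding is_lim_def by blast
    obtain l where "r (Suc l) = card (h z l) + 0" using hull_root[OF ok[OF z]] by blast
    then have "P 0 (z, l, l)" unfolding P_def using z r_less_m[of l] by simp
    then show "\<exists>x. P 0 x" by blast
  next
    fix x i assume "P i x"
    moreover obtain z l u where x: "x = (z, l, u)" by (metis prod_cases3)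
    ultimately have z: "z < d" by (simp add: P_def)
    obtain t z' y k0 k k1 where t: "t \<in> T' i" and z': "z' < d"
      and c: "catch h t (tx i) (tZ i) (tK i) z' y k0 k"
      and k1: "u < k1" "k1 < k" "branches_off h z z' k1" "card (h z' k1) = m k1"
      using jump_exists[OF lim ok V tx tZ z, of i i i "tK i" u] by blast
    have cz': "coherent h z'" using coherent z' by blast
    have "\<exists>k. tK i < k \<and> Suc k1 \<le> k \<and> branches_off h a z' k" if a: "a \<in> tZ i" for a
    proof -
      obtain l1 where "branches_off h a y l1" using c a unfolding catch_def by blast
      moreover have "y < z'" using c unfolding catch_def by blast
      ultimately have "a < z'" unfolding branches_off_def by auto
      then obtain k where "k > max (tK i) (Suc k1)" "branches_off h a z' k" using hull_branches_off[OF ok[OF z']] by blast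
      then show ?thesis by (intro exI[of _ k]) simp
    qed
    then obtain L where L: "\<forall>a\<in>tZ i. \<exists>k<L. tK i < k \<and> Suc k1 \<le> k \<and> branches_off h a z' k"
      using finite_bound[OF tZ(1)[of i], of "\<lambda>a k. tK i < k \<and> Suc k1 \<le> k \<and> branches_off h a z' k"] by auto
    obtain k2 where k2: "k2 > max (tK i) (Suc k1)" "r (Suc k2) = card (h z' k2) + Suc (ts i)"
      using hull_root[OF ok[OF z']] by blast
    define u' where "u' = Suc (max k (max k2 L))"
    \<comment> \<open>The full level-\<open>k1\<close> hull of \<open>z'\<close> does not grow at
      the next level, so from \<open>Suc k1\<close> on there is room above \<open>z'\<close> and it
      can be followed.\<close>
    have "h z' (Suc k1) = h z' k1" using xi_le_1_down[OF cz', of k1] k1(3) by (simp add: branches_off_def)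
    then have "card (h z' (Suc k1)) < m (Suc k1)" using k1(4) m_less_Suc by simp
    then have "P (Suc i) (z', Suc k1, u')" unfolding P_def u'_def using z' k1(2)
      by (simp add: le_max_iff_disj)
    moreover have "Q i x (z', Suc k1, u')"
    proof -
      have "\<exists>t\<in>T' i. \<exists>y k0 k. catch h t (tx i) (tZ i) (tK i) z' y k0 k \<and> Suc k1 \<le> k \<and> k < u'"
        by (rule bexI[OF _ t], rule exI[of _ y], rule exI[of _ k0], rule exI[of _ k])
          (use c k1(2) in \<open>simp add: u'_def\<close>)
      moreover have "\<exists>k>tK i. Suc k1 \<le> k \<and> k < u' \<and> branches_off h a z' k" if "a \<in> tZ i" for a
      proof -
        obtain k where "k < L" "tK i < k" "Suc k1 \<le> k" "branches_off h a z' k" using L \<open>a \<in> tZ i\<close> by blast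
        then show ?thesis unfolding u'_def by (intro exI[of _ k]) simp
      qed
      moreover have "\<exists>k>tK i. Suc k1 \<le> k \<and> k < u' \<and> r (Suc k) = card (h z' k) + Suc (ts i)"
        using k2 unfolding u'_def by (intro exI[of _ k2]) simp
      ultimately show ?thesis using k1 unfolding Q_def x by auto
    qed
    ultimately show "\<exists>y. P (Suc i) y \<and> Q i x y" by blast
  qed
  then obtain f where f: "\<And>i. P i (f i)" "\<And>i. Q i (f i) (f (Suc i))" by blast
  define z l u where zlu: "z = (\<lambda>i. fst (f i))" "l = (\<lambda>i. fst (snd (f i)))" "u = (\<lambda>i. snd (snd (f i)))"
  have fi: "f i = (z i, l i, u i)" for i by (simp add: zlu)
  show ?thesis
    by (rule exI[of _ z], rule exI[of _ l], rule exI[of _ u])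
      (use f in \<open>simp add: fi P_def Q_def\<close>)
qed

text \<open>The hulls of \<open>d\<close> are those of \<open>z i\<close>, plus \<open>d\<close>, at
  the levels between \<open>l i\<close> and \<open>l (Suc i)\<close>. Every requirement on
  \<open>d\<close> is one of countably many tasks and is settled at a level where \<open>d\<close>
  follows a point that already satisfies it.\<close>

lemma hull_ok_limit:
  fixes d :: "'a::wellorder"
  assumes lim: "is_lim d" and ok: "\<And>x. x < d \<Longrightarrow> hull_ok T h x" and cnt: "countable {..<d}"
  shows "\<exists>B. hull_ok T (h(d := B)) d"
proof -
  obtain x0 where x0: "x0 < d" using lim unfolding is_lim_def by blast
  \<comment> \<open>The entry \<open>ts i\<close> serves twice, as the stage \<open>s\<close> of a
    tuple set and as the offset \<open>j\<close> of the root clause.\<close>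
  obtain ts :: "nat \<Rightarrow> nat" and tx tZ and tK :: "nat \<Rightarrow> nat" where
    tasks: "\<forall>i. tx i < d \<and> finite (tZ i) \<and> tZ i \<subseteq> {..<d}"
      "\<forall>s x Z K. x < d \<and> finite Z \<and> Z \<subseteq> {..<d} \<longrightarrow>
        (\<exists>i. ts i = s \<and> tx i = x \<and> tZ i = Z \<and> tK i = K)"
    using enumerate_tasks[OF x0 cnt] by (elim exE conjE)
  have tx: "\<And>i. tx i < d" and tZ: "\<And>i. finite (tZ i)" "\<And>i. tZ i \<subseteq> {..<d}"
    using tasks(1) by auto
  have task: "\<exists>i. ts i = s \<and> tx i = x \<and> tZ i = Z \<and> tK i = K"
    if "x < d" "finite Z" "Z \<subseteq> {..<d}" for s x Z K
    using tasks(2)[rule_format] that by simp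
  \<comment> \<open>A tuple set that is not caught below \<open>d\<close> demands nothing at
    \<open>d\<close>; the empty tuple takes its place, so that the jumps can continue.\<close>
  define T' where "T' i = (if caught_below h (T (ts i) d) d then T (ts i) d else {[]})" for i
  have V: "caught_below h (T' i) d" for i
    unfolding T'_def using caught_below_Nil[OF lim ok] by simp
  have all_ok: "\<forall>x<d. hull_ok T h x" using ok by blast
  obtain z l u where zlu: "\<forall>i. z i < d \<and> l i \<le> u i \<and> card (h (z i) (l i)) < m (l i) \<and>
     (\<exists>k1. l (Suc i) = Suc k1 \<and> u i < k1 \<and> branches_off h (z i) (z (Suc i)) k1 \<and> card (h (z (Suc i)) k1) = m k1) \<and>
     (\<exists>t\<in>T' i. \<exists>y k0 k. catch h t (tx i) (tZ i) (tK i) (z (Suc i)) y k0 k \<and>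
        l (Suc i) \<le> k \<and> k < u (Suc i)) \<and>
     (\<forall>a\<in>tZ i. \<exists>k>tK i. l (Suc i) \<le> k \<and> k < u (Suc i) \<and> branches_off h a (z (Suc i)) k) \<and>
     (\<exists>k>tK i. l (Suc i) \<le> k \<and> k < u (Suc i) \<and> r (Suc k) = card (h (z (Suc i)) k) + Suc (ts i))"
    using jump_sequence[where T' = T' and tx = tx and tZ = tZ and tK = tK and ts = ts, OF lim all_ok V tx tZ]
    by (elim exE)
  note zlu' = zlu[rule_format]
  note seq = zlu'[THEN conjunct1] zlu'[THEN conjunct2, THEN conjunct1]
    zlu'[THEN conjunct2, THEN conjunct2, THEN conjunct1]
    zlu'[THEN conjunct2, THEN conjunct2, THEN conjunct2, THEN conjunct1]
  note rest = zlu'[THEN conjunct2, THEN conjunct2, THEN conjunct2, THEN conjunct2]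
  note seq_catch = rest[THEN conjunct1]
  note seq_J = rest[THEN conjunct2, THEN conjunct1, rule_format]
  note seq_root = rest[THEN conjunct2, THEN conjunct2]
  have coherent: "\<And>u. u < d \<Longrightarrow> coherent h u" using hull_coherent ok by blast
  have cz: "coherent h (z i)" for i using coherent seq(1) by blast
  have ul: "u i < l (Suc i)" for i using seq(4)[of i] by auto
  have l_less: "l i < l (Suc i)" for i using seq(2)[of i] ul[of i] by simp
  then have smono: "strict_mono l" by (simp add: strict_mono_Suc_iff)
  define idx where "idx k = (LEAST i. k < l (Suc i))" for k
  have idx_eq: "idx k = i" if "l i \<le> k" "k < l (Suc i)" for i k
    unfolding idx_def
  proof (rule Least_equality)
    show "k < l (Suc i)" by (rule that)
    fix j assume "k < l (Suc j)"
    then have "l i < l (Suc j)" using that by simp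
    then show "i \<le> j" using smono by (simp add: strict_mono_less)
  qed
  have idx: "l (idx k) \<le> k \<and> k < l (Suc (idx k))" if "l 0 \<le> k" for k
  proof -
    have ub: "k < l (Suc k)" using strict_mono_imp_increasing[OF smono, of "Suc k"] by simp
    have 1: "k < l (Suc (idx k))" unfolding idx_def by (rule LeastI[of _ k]) (rule ub)
    have "l (idx k) \<le> k"
    proof (cases "idx k")
      case 0
      then show ?thesis using that by simp
    next
      case (Suc j)
      then have "\<not> k < l (Suc j)" unfolding idx_def by (intro not_less_Least) simp
      then show ?thesis using Suc by simp
    qed
    with 1 show ?thesis by blast
  qed
  define A where "A k = h (z (idx k)) k" for k
  have nf: "card (h (z i) k) < m k" if "l i \<le> k" for i k
    using not_full_mono[OF cz seq(3) that] .
  have A_eq: "A k = h (z i) k" if "l i \<le> k" "k < l (Suc i)" for i k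
    unfolding A_def using idx_eq[OF that] by simp
  have "\<exists>B. (\<forall>k\<ge>l 0. B k = insert d (A k)) \<and> coherent (h(d := B)) d"
  proof (rule coherent_extend)
    show "coherent h g" if "g < d" for g using coherent that .
    fix k assume k: "l 0 \<le> k"
    show "finite (A k)" unfolding A_def using coherent_finite[OF cz] .
    show "A k \<subseteq> {..<d}" unfolding A_def using coherent_le[OF cz] le_less_trans[OF _ seq(1)] by blast
    show "card (A k) < m k" unfolding A_def using nf idx[OF k] by blast
    show "h g k = A k \<inter> {..g}" if "g \<in> A k" for g
      using coherent_restrict[OF cz] that unfolding A_def .
    define i where "i = idx k"
    have i: "l i \<le> k" "k < l (Suc i)" using idx[OF k] unfolding i_def by auto
    show "A k = {x \<in> A (Suc k). xi h k x = 0 \<or> xi h k x = block k (Suc (card (A (Suc k))))}"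
    \<comment> \<open>Inside an interval \<open>d\<close> follows a single point; between the last
      level of the interval and the next level it jumps from \<open>z i\<close> to
      \<open>z (Suc i)\<close>.\<close>
    proof (cases "Suc k < l (Suc i)")
      case True
      then have "A (Suc k) = h (z i) (Suc k)" using A_eq[of i "Suc k"] i by simp
      then show ?thesis using follow_coherent[OF cz nf[OF i(1)]] A_eq[OF i] by simp
    next
      case False
      then have eq: "Suc k = l (Suc i)" using i by simp
      then have "A (Suc k) = h (z (Suc i)) (Suc k)" using A_eq[of "Suc i" "Suc k"] l_less[of "Suc i"] by simp
      moreover have "branches_off h (z i) (z (Suc i)) k" "card (h (z (Suc i)) k) = m k"
        using seq(4)[of i] eq by auto
      ultimately show ?thesis using jump_coherent[OF cz] A_eq[OF i] by simp
    qed
  next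
    fix g assume g: "g < d"
    \<comment> \<open>The task with \<open>Z = {g}\<close> puts \<open>g\<close> into the hull of
      some \<open>z (Suc i)\<close> while \<open>d\<close> follows that point.\<close>
    obtain i where i: "tZ i = {g}" using task[of g "{g}" 0 0] g by auto
    then obtain k where k: "l (Suc i) \<le> k" "k < u (Suc i)" "branches_off h g (z (Suc i)) k"
      using seq_J[of g i] by auto
    have "k < l (Suc (Suc i))" using k(2) ul[of "Suc i"] by simp
    then have "g \<in> A k" using A_eq[OF k(1)] k(3) by (simp add: branches_off_def)
    moreover have "l 0 \<le> k" using k(1) smono by (meson le_trans strict_mono_less_eq zero_le)
    ultimately show "\<exists>k\<ge>l 0. g \<in> A k" by blast
  qed
  then obtain B where B: "\<And>k. l 0 \<le> k \<Longrightarrow> B k = insert d (A k)" "coherent (h(d := B)) d" by blast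
  let ?h = "h(d := B)"
  have B': "B k = insert d (h (z i) k)" if "l i \<le> k" "k < l (Suc i)" for i k
  proof -
    have "l 0 \<le> k" using that(1) smono by (meson le_trans strict_mono_less_eq zero_le)
    then show ?thesis using B(1) A_eq[OF that] by simp
  qed
  have Bu: "B k = insert d (h (z i) k)" "B (Suc k) = insert d (h (z i) (Suc k))"
    if "l i \<le> k" "k < u i" for i k
    using B'[of i k] B'[of i "Suc k"] that ul[of i] by auto
  have "hull_ok T ?h d" unfolding hull_ok_def
  proof (intro conjI allI impI)
    show "coherent ?h d" by (rule B(2))
    show "\<exists>k>K. r (Suc k) = card (?h d k) + j" for j K
    proof -
      obtain i where i: "ts i = j" "tK i = K" using task[of x0 "{}" j K] x0 by auto
      obtain k where k: "k > K" "l (Suc i) \<le> k" "k < u (Suc i)" "r (Suc k) = card (h (z (Suc i)) k) + Suc j"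
        using seq_root[of i] i by auto
      have "d \<notin> h (z (Suc i)) k" using coherent_le[OF cz] seq(1) by (meson leD)
      then have "card (?h d k) = Suc (card (h (z (Suc i)) k))"
        using Bu(1)[OF k(2,3)] coherent_finite[OF cz] by simp
      then show ?thesis using k by (intro exI[of _ k]) simp
    qed
    show "\<exists>k>K. branches_off ?h a d k" if "a < d" for a K
    proof -
      obtain i where i: "tZ i = {a}" "tK i = K" using task[of x0 "{a}" 0 K] x0 \<open>a < d\<close> by auto
      obtain k where k: "k > K" "l (Suc i) \<le> k" "k < u (Suc i)" "branches_off h a (z (Suc i)) k"
        using seq_J[of a i] i by auto
      have "branches_off ?h a d k"
        by (rule follow_top_branches_off[OF cz seq(1) nf[OF k(2)] refl Bu[OF k(2,3)] k(4)])
      then show ?thesis using k(1) by blast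
    qed
    show "?h d k = insert d (?h b k)" if "is_succ b d \<and> card (?h b k) < m k" for b k
      using that lim unfolding is_succ_def is_lim_def by (meson leD)
    show "caught_at ?h (T s d) d" if below: "is_lim d \<and> caught_below ?h (T s d) d" for s
      unfolding caught_at_def
    proof (intro allI impI)
      fix x Z K assume "x < d" "finite Z \<and> Z \<subseteq> {..<d}"
      then obtain i where i: "ts i = s" "tx i = x" "tZ i = Z" "tK i = K" using task by meson
      have "caught_below h (T s d) d"
        by (rule caught_below_cong[of d ?h h]) (use below in auto)
      then have "T' i = T s d" using i by (simp add: T'_def)
      then obtain t y k0 k where t: "t \<in> T s d" and c: "catch h t x Z K (z (Suc i)) y k0 k"
        and k: "l (Suc i) \<le> k" "k < u (Suc i)" using seq_catch[of i] i by auto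
      have "catch ?h t x Z K d y k0 k"
        by (rule follow_top_catch[OF cz seq(1) nf[OF k(1)] refl Bu[OF k] c])
      then show "\<exists>t\<in>T s d. \<exists>y k0 k. catch ?h t x Z K d y k0 k" using t by blast
    qed
  qed
  then show ?thesis by blast
qed

theorem hull_exists:
  fixes T :: "nat \<Rightarrow> 'a::wellorder \<Rightarrow> 'a set list set"
  assumes "\<And>x::'a. countable {..<x}"
  shows "\<exists>h. \<forall>d. hull_ok T h d"
proof -
  have "\<exists>h. \<forall>d. hull_ok T (h(d := h d)) d"
  \<comment> \<open>The update \<open>h(d := B)\<close> presents \<open>h d\<close> as a choice that
    depends on earlier values only, which \<open>hull_ok_cong\<close> justifies.\<close>
  proof (rule dependent_wellorder_choice[where P = "\<lambda>h d B. hull_ok T (h(d := B)) d"])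
    show "hull_ok T (f(d := B)) d = hull_ok T (g(d := B)) d" if "\<And>y. y < d \<Longrightarrow> f y = g y" for B f g d
    proof -
      have "(f(d := B)) y = (g(d := B)) y" if "y \<le> d" for y
        using \<open>\<And>y. y < d \<Longrightarrow> f y = g y\<close> that by simp
      then show ?thesis
        using hull_ok_cong[of d "f(d := B)" "g(d := B)"] hull_ok_cong[of d "g(d := B)" "f(d := B)"] by metis
    qed
    show "\<exists>B. hull_ok T (f(d := B)) d" if "\<And>y. y < d \<Longrightarrow> hull_ok T (f(y := f y)) y" for d f
    proof -
      have ok: "\<And>y. y < d \<Longrightarrow> hull_ok T f y" using that by simp
      show ?thesis
      proof (cases "is_lim d")
        case True
        then show ?thesis using hull_ok_limit[OF _ ok assms] by blast
      next
        case False
        show ?thesis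
        proof (cases "\<exists>b. b < d")
          case True
          then obtain b where "is_succ b d" using is_lim_or_succ False by blast
          then show ?thesis using hull_ok_successor ok by blast
        qed (use hull_ok_least in blast)
      qed
    qed
  qed
  then show ?thesis by simp
qed

end

section \<open>The scheme of full hulls\<close>

lemma sorted_list_of_set_setless_Un:
  assumes "finite A" "finite B" "setless A B"
  shows "sorted_list_of_set (A \<union> B) = sorted_list_of_set A @ sorted_list_of_set B"
proof (rule sorted_distinct_set_unique)
  show "sorted (sorted_list_of_set A @ sorted_list_of_set B)"
    using assms by (auto simp: sorted_append setless_def intro: less_imp_le)
  show "distinct (sorted_list_of_set A @ sorted_list_of_set B)"
    using assms by (auto simp: setless_def)
qed (use assms in auto)

lemma elem_setless_Un:
  assumes "finite A" "finite B" "setless A B" "a < card A + card B"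
  shows "a < card A \<Longrightarrow> elem (A \<union> B) a \<in> A" and "\<not> a < card A \<Longrightarrow> elem (A \<union> B) a \<in> B"
proof -
  have e: "elem (A \<union> B) a = (sorted_list_of_set A @ sorted_list_of_set B) ! a"
    unfolding elem_def sorted_list_of_set_setless_Un[OF assms(1-3)] ..
  show "elem (A \<union> B) a \<in> A" if "a < card A"
  proof -
    have "sorted_list_of_set A ! a \<in> set (sorted_list_of_set A)" using that by (intro nth_mem) simp
    then show ?thesis using that assms(1) by (simp add: e nth_append)
  qed
  show "elem (A \<union> B) a \<in> B" if "\<not> a < card A"
  proof -
    have "sorted_list_of_set B ! (a - card A) \<in> set (sorted_list_of_set B)"
      using that assms(4) by (intro nth_mem) simp
    then show ?thesis using that assms(2) by (simp add: e nth_append)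
  qed
qed

context scheme_type
begin

definition hull_family :: "('a::wellorder \<Rightarrow> nat \<Rightarrow> 'a set) \<Rightarrow> 'a set set" where
  "hull_family h = {h b k | b k. card (h b k) = m k}"

lemma level_hull_family: "level m (hull_family h) k = {h b k | b. card (h b k) = m k}"
  unfolding level_def hull_family_def using strict_mono_eq[OF m_strict_mono] by auto

lemma hull_decomp:
  assumes c: "\<And>x. coherent h x" and full: "card (h b (Suc k)) = m (Suc k)"
  shows "decomp m n r (hull_family h) k (h b (Suc k)) {x \<in> h b (Suc k). xi h k x = 0}
    (\<lambda>i. {x \<in> h b (Suc k). xi h k x = 0 \<or> xi h k x = Suc i})"
proof -
  let ?F = "h b (Suc k)"
  let ?Fs = "\<lambda>i. {x \<in> ?F. xi h k x = 0 \<or> xi h k x = Suc i}"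
  let ?R = "{x \<in> ?F. xi h k x = 0}"
  have less: "x < y" if "x \<in> ?F" "y \<in> ?F" "xi h k x < xi h k y" for x y
    using xi_mono[OF c that(2,1)] that(3) by (meson leD not_le)
  have "?F \<subseteq> (\<Union>i<n (Suc k). ?Fs i)"
  proof
    fix x assume x: "x \<in> ?F"
    show "x \<in> (\<Union>i<n (Suc k). ?Fs i)"
    proof (cases "xi h k x")
      case 0
      then show ?thesis using x n_ge_2[of k] by (intro UN_I[of 0]) auto
    next
      case (Suc i)
      then show ?thesis using x xi_le_n[OF c, of k x] by (intro UN_I[of i]) auto
    qed
  qed
  then have 1: "?F = (\<Union>i<n (Suc k). ?Fs i)" by auto
  have 2: "?Fs i \<in> level m (hull_family h) k" if "i < n (Suc k)" for i
  proof -
    have "1 \<le> Suc i" "Suc i \<le> n (Suc k)" using that by auto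
    from full_block[OF c full this] obtain f where "card (h f k) = m k" "h f k = ?Fs i" by blast
    then show ?thesis unfolding level_hull_family by blast
  qed
  have "card ?R = r (Suc k)"
  proof -
    let ?f = "\<lambda>x. card (h x (Suc k))"
    have bij: "bij_betw ?f ?F {1..m (Suc k)}" using rank_bij[OF c[of b], of "Suc k"] full by simp
    have le: "r (Suc k) \<le> m (Suc k)" using m_Suc[of k] by simp
    have "?f ` ?R = {p \<in> ?f ` ?F. p \<le> r (Suc k)}"
      by (auto simp: xi_def block_eq_0)
    also have "\<dots> = {1..r (Suc k)}"
      using bij le by (auto simp: bij_betw_def)
    finally have "card (?f ` ?R) = r (Suc k)" by simp
    moreover have "inj_on ?f ?R" using bij by (auto simp: bij_betw_def intro: inj_on_subset)
    ultimately show ?thesis by (simp add: card_image)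
  qed
  moreover have "setless ?R (?Fs 0 - ?R)"
    unfolding setless_def using less by auto
  moreover have "setless (?Fs i - ?R) (?Fs (Suc i) - ?R)" for i
    unfolding setless_def using less by auto
  ultimately show ?thesis unfolding decomp_def using 1 2 by auto
qed

text \<open>The hull of the maximum of a finite set contains the whole set at high levels, and
  successors enlarge it to a full hull; this gives cofinality. Two level-\<open>k\<close> hulls
  through a common point agree below it, which gives the initial segments.\<close>

lemma hull_scheme:
  fixes h :: "'a::wellorder \<Rightarrow> nat \<Rightarrow> 'a set"
  assumes ok: "\<And>x. hull_ok T h x" and succ: "\<And>x::'a. \<exists>y. is_succ x y"
  shows "construction_scheme m n r UNIV (hull_family h)"
  unfolding construction_scheme_def
proof (intro conjI ballI allI impI)
  have c: "\<And>x. coherent h x" using hull_coherent ok by blast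
  fix F assume "F \<in> hull_family h"
  then obtain b k where F: "F = h b k" "card (h b k) = m k" unfolding hull_family_def by blast
  show "F \<noteq> {}" "finite F" "F \<subseteq> UNIV" "\<exists>k. card F = m k"
    using F coherent_self[OF c, of b k] coherent_finite[OF c, of b k] by auto
next
  have c: "\<And>x. coherent h x" using hull_coherent ok by blast
  fix A :: "'a set" assume A: "finite A \<and> A \<subseteq> UNIV"
  define b where "b = (if A = {} then undefined else Max A)"
  have "\<exists>k. a \<in> h b k" if "a \<in> A" for a
  proof -
    have "a \<le> b" unfolding b_def using A that by auto
    then show ?thesis using coherent_cover[OF c] by blast
  qed
  then obtain K where K: "\<forall>a\<in>A. \<exists>k<K. a \<in> h b k" using finite_bound[of A "\<lambda>a k. a \<in> h b k"] A by auto
  have AK: "A \<subseteq> h b K"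
  proof
    fix a assume "a \<in> A"
    then obtain k where "k < K" "a \<in> h b k" using K by blast
    then show "a \<in> h b K" using coherent_mono[OF c, of k K] by auto
  qed
  have "\<exists>z\<in>UNIV. b \<in> h z K \<and> card (h z K) = m K"
    by (rule full_exists[of _ T]) (use ok succ in auto)
  then obtain z where z: "b \<in> h z K" "card (h z K) = m K" by blast
  have "A \<subseteq> h z K" using AK coherent_sub[OF c z(1)] by blast
  then show "\<exists>F\<in>hull_family h. A \<subseteq> F" using z(2) unfolding hull_family_def by blast
next
  have c: "\<And>x. coherent h x" using hull_coherent ok by blast
  fix k E F assume "E \<in> level m (hull_family h) k" "F \<in> level m (hull_family h) k"
  then obtain b b' where E: "E = h b k" and F: "F = h b' k" unfolding level_hull_family by blast
  have "E \<inter> {..x} = F \<inter> {..x}" if "x \<in> E \<inter> F" for x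
    using coherent_restrict[OF c, of x b k] coherent_restrict[OF c, of x b' k] that E F by blast
  then have "y \<in> E \<longleftrightarrow> y \<in> F" if "x \<in> E \<inter> F" "y < x" for x y
    using that by (metis IntD1 IntI atMost_iff less_imp_le)
  then show "init_seg (E \<inter> F) E" "init_seg (E \<inter> F) F" unfolding init_seg_def by auto
next
  have c: "\<And>x. coherent h x" using hull_coherent ok by blast
  fix k F assume "F \<in> level m (hull_family h) (Suc k)"
  then obtain b where "F = h b (Suc k)" "card (h b (Suc k)) = m (Suc k)"
    unfolding level_hull_family by blast
  then show "\<exists>R Fs. decomp m n r (hull_family h) k F R Fs" using hull_decomp[OF c] by blast
qed

text \<open>All sets lie in one level-\<open>k + 1\<close> set, with \<open>R\<close> in its root
  and the tails in successive pieces. A hull of level at most \<open>k\<close> meets only one piece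
  outside the root, so \<open>rho\<close> of two points from different pieces is exactly
  \<open>Suc k\<close>.\<close>

lemma rho_captured_hull:
  assumes c: "\<And>x. coherent h x" and full: "card (h f (Suc k)) = m (Suc k)"
    and len: "length tt \<ge> 2" and R: "finite R"
    and RE: "\<And>x. x \<in> R \<Longrightarrow> x \<in> h f (Suc k) \<and> xi h k x = 0"
    and tt: "\<And>i. i < length tt \<Longrightarrow> finite (tt ! i) \<and> card (tt ! i) = q \<and> setless R (tt ! i)" "q > 0"
    and ttE: "\<And>i x. i < length tt \<Longrightarrow> x \<in> tt ! i \<Longrightarrow> x \<in> h f (Suc k) \<and> xi h k x = Suc i"
  shows "rho_captured m n r (hull_family h) (\<lambda>i. R \<union> tt ! i) (length tt) (Suc k)"
proof -
  let ?D = "\<lambda>i. R \<union> tt ! i" and ?E = "h f (Suc k)"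
  have Rt: "R \<inter> tt ! i = {}" if "i < length tt" for i
    using RE ttE[OF that] by fastforce
  have disj: "tt ! i \<inter> tt ! j = {}" if "i < length tt" "j < length tt" "i \<noteq> j" for i j
    using ttE[OF that(1)] ttE[OF that(2)] that(3) by fastforce
  have D_R: "?D i - R = tt ! i" if "i < length tt" for i using Rt[OF that] by blast
  have cardD: "card (?D i) = card R + q" if "i < length tt" for i
    using card_Un_disjoint[of R "tt ! i"] Rt[OF that] tt(1)[OF that] R by simp
  have "setless (tt ! i) (tt ! Suc i)" if "Suc i < length tt" for i
    unfolding setless_def
  proof (intro ballI)
    fix x y assume "x \<in> tt ! i" "y \<in> tt ! Suc i"
    then have x: "x \<in> ?E" "xi h k x = Suc i" and y: "y \<in> ?E" "xi h k y = Suc (Suc i)"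
      using ttE[of i x] ttE[of "Suc i" y] that by auto
    show "x < y" using xi_mono[OF c y(1) x(1)] x(2) y(2) by fastforce
  qed
  moreover have "?D i \<inter> ?D j = R" if "i < length tt" "j < length tt" "i \<noteq> j" for i j
    using disj[OF that] by blast
  ultimately have rtt: "rtt_delta ?D (length tt) (card R + q) R"
    unfolding rtt_delta_def using len R tt(1) cardD D_R by auto
  have len_le: "length tt \<le> n (Suc k)"
  proof -
    define i where "i = length tt - 1"
    have i: "i < length tt" "Suc i = length tt" unfolding i_def using len by auto
    then obtain x where "x \<in> tt ! i" using tt(1)[OF i(1)] tt(2) by fastforce
    then show ?thesis using ttE[OF i(1)] xi_le_n[OF c, of k x] i(2) by simp
  qed
  have Xi: "Xi_is m n r (hull_family h) (elem (?D i) a) (Suc k) (if a < card R then - 1 else int i)"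
    if i: "i < length tt" and a: "a < card R + q" for i a
  proof -
    have E: "?E \<in> level m (hull_family h) (Suc k)" unfolding level_hull_family using full by blast
    show ?thesis
    proof (cases "a < card R")
      case True
      then have "elem (?D i) a \<in> R" using elem_setless_Un(1)[OF R] tt(1)[OF i] a by blast
      then have "elem (?D i) a \<in> ?E" "xi h k (elem (?D i) a) = 0" using RE by auto
      then show ?thesis using True E hull_decomp[OF c full] unfolding Xi_is_def
        by (intro conjI bexI[of _ ?E] exI[of _ "{x \<in> ?E. xi h k x = 0}"]
            exI[of _ "\<lambda>i. {x \<in> ?E. xi h k x = 0 \<or> xi h k x = Suc i}"]) auto
    next
      case False
      then have "elem (?D i) a \<in> tt ! i" using elem_setless_Un(2)[OF R] tt(1)[OF i] a by blast
      then have "elem (?D i) a \<in> ?E" "xi h k (elem (?D i) a) = Suc i" using ttE[OF i] by auto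
      then show ?thesis using False E hull_decomp[OF c full] unfolding Xi_is_def
        by (intro conjI bexI[of _ ?E] exI[of _ "{x \<in> ?E. xi h k x = 0}"]
            exI[of _ "\<lambda>i. {x \<in> ?E. xi h k x = 0 \<or> xi h k x = Suc i}"]) auto
    qed
  qed
  have rho: "rho m (hull_family h) (elem (?D i) a) (elem (?D j) a) = Suc k"
    if ij: "i < j" "j < length tt" and a: "card R \<le> a" "a < card R + q" for i j a
  proof -
    have i: "i < length tt" using ij by simp
    let ?x = "elem (?D i) a" and ?y = "elem (?D j) a"
    have "?x \<in> tt ! i" using elem_setless_Un(2)[OF R] tt(1)[OF i] a by (meson leD)
    then have x: "?x \<in> ?E" "xi h k ?x = Suc i" using ttE[OF i] by auto
    have "?y \<in> tt ! j" using elem_setless_Un(2)[OF R] tt(1)[OF ij(2)] a by (meson leD)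
    then have y: "?y \<in> ?E" "xi h k ?y = Suc j" using ttE[OF ij(2)] by auto
    show ?thesis unfolding rho_def
    proof (rule Least_equality)
      show "\<exists>F\<in>level m (hull_family h) (Suc k). {?x, ?y} \<subseteq> F"
        unfolding level_hull_family using full x(1) y(1) by blast
      fix k' assume "\<exists>F\<in>level m (hull_family h) k'. {?x, ?y} \<subseteq> F"
      then obtain g where g: "?x \<in> h g k'" "?y \<in> h g k'" unfolding level_hull_family by blast
      show "Suc k \<le> k'"
      proof (rule ccontr)
        assume "\<not> Suc k \<le> k'"
        then have "h g k' \<subseteq> h g k" using coherent_mono[OF c] by simp
        then have "xi h k ?x = xi h k g" "xi h k ?y = xi h k g"
          using coherent_xi[OF c, of ?x g k] coherent_xi[OF c, of ?y g k] g x(2) y(2) by auto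
        then show False using x(2) y(2) ij(1) by simp
      qed
    qed
  qed
  show ?thesis unfolding rho_captured_def
    by (intro conjI exI[of _ "card R + q"] exI[of _ R] allI impI)
      (simp, rule rtt, rule len_le, rule Xi, assumption+, rule rho, simp_all)
qed

text \<open>The hull \<open>h u k\<close> contains \<open>d\<close> and \<open>W\<close>, and
  \<open>W\<close> lies above \<open>d\<close>, hence outside the root; so \<open>W\<close> is in
  the piece of \<open>d\<close>, the one right after those of \<open>t\<close>. Thus
  \<open>t @ [W]\<close> occupies consecutive pieces of any level-\<open>k + 1\<close> hull through
  \<open>u\<close>.\<close>

lemma catch_tail:
  assumes c: "\<And>x. coherent h x" and ct: "catch h t x Z K d y k0 k"
    and W: "\<forall>v\<in>W. d < v \<and> v \<in> h u k" and d: "d \<in> h u k" and f: "u \<in> h f (Suc k)"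
  shows "y \<in> h f (Suc k)" "xi h k y = 0" "h y k \<subseteq> h f (Suc k)"
    and "\<And>i v. i \<le> length t \<Longrightarrow> v \<in> (t @ [W]) ! i \<Longrightarrow> v \<in> h f (Suc k) \<and> xi h k v = Suc i"
proof -
  have y: "y \<in> h d k" "r (Suc k) = card (h y k)" and xd: "xi h k d = Suc (length t)"
    using ct by (auto simp: catch_def)
  have uf: "h u (Suc k) \<subseteq> h f (Suc k)" using coherent_sub[OF c f] .
  have k: "h u k \<subseteq> h u (Suc k)" using coherent_mono[OF c] by simp
  have df: "h d (Suc k) \<subseteq> h f (Suc k)" using coherent_sub[OF c, of d u "Suc k"] d k uf by blast
  have dk: "h d k \<subseteq> h d (Suc k)" using coherent_mono[OF c] by simp
  show "h y k \<subseteq> h f (Suc k)" using coherent_sub[OF c y(1)] dk df by blast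
  show "y \<in> h f (Suc k)" using y(1) dk df by blast
  show "xi h k y = 0" using xi_eq_0[OF c] y(2) by simp
  show "v \<in> h f (Suc k) \<and> xi h k v = Suc i" if "i \<le> length t" "v \<in> (t @ [W]) ! i" for i v
  proof (cases "i < length t")
    case True
    then have "v \<in> t ! i" using that by (simp add: nth_append)
    then have "v \<in> h d (Suc k)" "xi h k v = Suc i" using ct True by (auto simp: catch_def)
    then show ?thesis using df by blast
  next
    case False
    then have i: "i = length t" and "v \<in> W" using that by (simp_all add: nth_append)
    then have v: "d < v" "v \<in> h u k" using W by auto
    have "xi h k u = Suc (length t)" using coherent_xi[OF c d] xd by simp
    moreover have "xi h k d \<le> xi h k v" using xi_mono[OF c, of d u k v] d v k less_imp_le by blast
    ultimately have "xi h k v = Suc i" using coherent_xi[OF c v(2)] xd i by auto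
    then show ?thesis using v(2) k uf by blast
  qed
qed

lemma eventually_subset:
  assumes c: "coherent h b" and "finite A" "\<And>a. a \<in> A \<Longrightarrow> a \<le> b"
  shows "\<exists>K. \<forall>k\<ge>K. A \<subseteq> h b k"
proof -
  have "\<exists>K. \<forall>a\<in>A. \<exists>k<K. a \<in> h b k"
    using finite_bound[OF assms(2), of "\<lambda>a k. a \<in> h b k"] coherent_cover[OF c] assms(3) by auto
  then obtain K where K: "\<forall>a\<in>A. \<exists>k<K. a \<in> h b k" ..
  have "A \<subseteq> h b k" if "K \<le> k" for k
  proof
    fix a assume "a \<in> A"
    then obtain l where "l < K" "a \<in> h b l" using K by blast
    then show "a \<in> h b k" using coherent_mono[OF c, of l k] that by auto
  qed
  then show ?thesis by blast
qed

end

section \<open>Combinatorics of \<open>\<omega>\<^sub>1\<close>\<close>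

locale omega1 =
  fixes ty :: "'a::wellorder itself"
  assumes omega1: "omega1_like TYPE('a)"
begin

lemma countable_initial: "countable {..<x::'a}" "countable {..x}"
proof -
  show 1: "countable {..<x}" using omega1 unfolding omega1_like_def lessThan_def by blast
  have "{..x} = insert x {..<x}" by auto
  then show "countable {..x}" using 1 by simp
qed

lemma countable_bounded:
  assumes "countable (A :: 'a set)"
  shows "\<exists>b. \<forall>a\<in>A. a < b"
proof (rule ccontr)
  assume "\<not> ?thesis"
  then have "UNIV \<subseteq> (\<Union>a\<in>A. {..a})" by (auto simp: not_less)
  moreover have "countable (\<Union>a\<in>A. {..a})" using assms countable_initial(2) by blast
  ultimately show False using omega1 countable_subset unfolding omega1_like_def by blast
qed

lemma unbounded_uncountable:
  assumes "\<And>b. \<exists>a\<in>A. b < a"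
  shows "\<not> countable (A :: 'a set)"
proof
  assume "countable A"
  then obtain b where "\<forall>a\<in>A. a < b" using countable_bounded by blast
  then show False using assms[of b] by (meson less_asym)
qed

lemma succ_exists: "\<exists>y. is_succ (x::'a) y"
  using countable_bounded[of "{x}"] is_succ_exists by auto

text \<open>For unboundedness, iterate a function that dominates \<open>g\<close> on initial
  segments; the supremum of the iterates is a closure point.\<close>

lemma club_closure_points:
  fixes g :: "'a \<Rightarrow> 'a"
  shows "club {c. is_lim c \<and> b < c \<and> (\<forall>x<c. g x < c)}"
  unfolding club_def
proof (intro conjI allI impI)
  fix b0 :: 'a
  have "\<exists>u. x < u \<and> (\<forall>y\<le>x. g y < u)" for x
  proof -
    have "countable (insert x (g ` {..x}))" using countable_initial(2) by simp
    then obtain u where "\<forall>a\<in>insert x (g ` {..x}). a < u" using countable_bounded by blast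
    then show ?thesis by (intro exI[of _ u]) auto
  qed
  then obtain F where F: "\<And>x. x < F x" "\<And>x y. y \<le> x \<Longrightarrow> g y < F x" by metis
  define s where "s i = (F ^^ i) (max b0 b)" for i
  have s_Suc: "s (Suc i) = F (s i)" for i by (simp add: s_def)
  obtain u where u: "\<forall>a\<in>range s. a < u" using countable_bounded[of "range s"] by auto
  define c where "c = (LEAST u. \<forall>i. s i < u)"
  have sc: "s i < c" for i
    unfolding c_def by (rule LeastI2[of _ u]) (use u in auto)
  have below: "\<exists>i. x \<le> s i" if "x < c" for x
    using not_less_Least[of x "\<lambda>u. \<forall>i. s i < u"] that unfolding c_def by (auto simp: not_less)
  have s0: "s 0 = max b0 b" by (simp add: s_def)
  have "b0 < c" "b < c" using sc[of 0] unfolding s0 by auto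
  moreover have "is_lim c" unfolding is_lim_def
  proof (intro conjI allI impI)
    show "\<exists>x. x < c" using sc by blast
    fix x assume "x < c"
    then obtain i where "x \<le> s i" using below by blast
    then have "x < s (Suc i)" using F(1)[of "s i"] s_Suc by simp
    then show "\<exists>y. x < y \<and> y < c" using sc by blast
  qed
  moreover have "g x < c" if xc: "x < c" for x
  proof -
    obtain i where "x \<le> s i" using below[OF xc] by blast
    then show ?thesis using F(2)[of x "s i"] sc[of "Suc i"] s_Suc by simp
  qed
  ultimately show "\<exists>c\<in>{c. is_lim c \<and> b < c \<and> (\<forall>x<c. g x < c)}. b0 < c" by blast
next
  fix d assume d: "is_lim d \<and> (\<forall>x<d. \<exists>c\<in>{c. is_lim c \<and> b < c \<and> (\<forall>x<c. g x < c)}. x < c \<and> c < d)"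
  then have lim: "is_lim d"
    and d': "\<And>x. x < d \<Longrightarrow> \<exists>c. b < c \<and> (\<forall>x<c. g x < c) \<and> x < c \<and> c < d" by auto
  have "g x < d" if xd: "x < d" for x
  proof -
    obtain c where "x < c" "c < d" "g x < c" using d'[OF xd] by blast
    then show ?thesis by simp
  qed
  moreover have "b < d"
  proof -
    obtain x where "x < d" using lim unfolding is_lim_def by blast
    then obtain c where "c < d" "b < c" using d' by blast
    then show ?thesis by simp
  qed
  ultimately show "d \<in> {c. is_lim c \<and> b < c \<and> (\<forall>x<c. g x < c)}" using lim by blast
qed

text \<open>A finite set is determined by its maximum and its index among the countably many finite
  sets up to that maximum, and such pairs inject into the infinite type. With these codes
  \<clubsuit> can guess sets of finite sets.\<close>

lemma inj_finite_sets: "\<exists>e :: 'a set \<Rightarrow> 'a. inj_on e {U. finite U \<and> U \<noteq> {}}"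
proof -
  have inf: "infinite (UNIV :: 'a set)"
    using omega1 countable_finite unfolding omega1_like_def by blast
  have "\<exists>f :: 'a \<times> nat \<Rightarrow> 'a. inj f"
  proof -
    have "(card_of (UNIV :: nat set), card_of (UNIV :: 'a set)) \<in> ordLeq"
      using inf by (simp add: infinite_iff_card_of_nat)
    then have "(card_of ((UNIV :: 'a set) \<times> (UNIV :: nat set)), card_of (UNIV :: 'a set)) \<in> ordIso"
      using card_of_Times_infinite[OF inf, of "UNIV :: nat set"] by auto
    then have "(card_of ((UNIV :: 'a set) \<times> (UNIV :: nat set)), card_of (UNIV :: 'a set)) \<in> ordLeq"
      using ordIso_iff_ordLeq by blast
    then show ?thesis unfolding card_of_ordLeq[symmetric] by auto
  qed
  then obtain f :: "'a \<times> nat \<Rightarrow> 'a" where f: "inj f" ..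
  define N where "N b = {U. finite U \<and> U \<subseteq> {..b::'a}}" for b
  have N: "countable (N b)" for b
    unfolding N_def using countable_Collect_finite_subset[OF countable_initial(2)] .
  let ?e = "\<lambda>U. f (Max U, to_nat_on (N (Max U)) U)"
  have "inj_on ?e {U. finite U \<and> U \<noteq> {}}"
  proof (rule inj_onI)
    fix U V assume U: "U \<in> {U. finite U \<and> U \<noteq> {}}" and V: "V \<in> {U. finite U \<and> U \<noteq> {}}"
      and "?e U = ?e V"
    then have eq: "Max U = Max V" "to_nat_on (N (Max U)) U = to_nat_on (N (Max U)) V"
      using injD[OF f] by fastforce+
    have "U \<in> N (Max U)" "V \<in> N (Max V)" using U V unfolding N_def by auto
    then show "U = V" using eq to_nat_on_inj[OF N] by metis
  qed
  then show ?thesis by blast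
qed

text \<open>By induction on the size. If members of \<open>S\<close> lie arbitrarily high, the root
  is empty. Otherwise the minima are bounded, so uncountably many members share one, which is
  removed and later put back into the root.\<close>

lemma delta_system_card:
  assumes "\<not> countable (S :: 'a set set)" "\<And>D. D \<in> S \<Longrightarrow> finite D \<and> card D = c"
  shows "\<exists>R q. finite R \<and> q > 0 \<and>
    (\<forall>b. \<exists>W. R \<union> W \<in> S \<and> setless R W \<and> finite W \<and> card W = q \<and> (\<forall>v\<in>W. b < v))"
  using assms
proof (induction c arbitrary: S)
  case 0
  have "S \<subseteq> {{}}"
  proof
    fix D assume "D \<in> S"
    then show "D \<in> {{}}" using 0(2)[of D] by (auto simp: card_eq_0_iff)
  qed
  then have "countable S" using countable_subset[of S "{{}}"] by simp
  then show ?case using 0(1) by simp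
next
  case (Suc c)
  show ?case
  proof (cases "\<forall>b. \<exists>D\<in>S. \<forall>v\<in>D. b < v")
    case True
    have "\<exists>W. {} \<union> W \<in> S \<and> setless {} W \<and> finite W \<and> card W = Suc c \<and> (\<forall>v\<in>W. b < v)" for b
    proof -
      obtain D where "D \<in> S" "\<forall>v\<in>D. b < v" using True[rule_format, of b] by blast
      then show ?thesis using Suc.prems(2)[of D] by (intro exI[of _ D]) (simp add: setless_def)
    qed
    then show ?thesis by (intro exI[of _ "{}"] exI[of _ "Suc c"]) simp
  next
    case False
    then obtain b where b: "\<And>D. D \<in> S \<Longrightarrow> \<exists>v\<in>D. v \<le> b" by (auto simp: not_less)
    have "Min D \<le> b" if "D \<in> S" for D
      using b[OF that] Suc.prems(2)[OF that] by (meson Min_le order_trans)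
    then have S: "S \<subseteq> (\<Union>a\<in>{..b}. {D \<in> S. Min D = a})" by auto
    have "\<exists>a. \<not> countable {D \<in> S. Min D = a}"
    proof (rule ccontr)
      assume "\<not> ?thesis"
      then have "countable (\<Union>a\<in>{..b}. {D \<in> S. Min D = a})"
        by (intro countable_UN countable_initial(2)) blast
      then show False using S Suc.prems(1) countable_subset by blast
    qed
    then obtain a where a: "\<not> countable {D \<in> S. Min D = a}" ..
    let ?Sa = "{D \<in> S. Min D = a}"
    have aD: "a \<in> D" if "D \<in> ?Sa" for D
    proof -
      have D: "D \<in> S" "Min D = a" using that by simp_all
      have "finite D" "D \<noteq> {}" using Suc.prems(2)[OF D(1)] by auto
      then show ?thesis using Min_in[of D] D(2) by simp
    qed
    have "inj_on (\<lambda>D. D - {a}) ?Sa"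
    proof (rule inj_onI)
      fix D D' assume D: "D \<in> ?Sa" and D': "D' \<in> ?Sa" and eq: "D - {a} = D' - {a}"
      show "D = D'" using aD[OF D] aD[OF D'] eq by blast
    qed
    then have unc: "\<not> countable ((\<lambda>D. D - {a}) ` ?Sa)" using a countable_image_inj_on by blast
    have cd: "finite D' \<and> card D' = c" if D': "D' \<in> (\<lambda>D. D - {a}) ` ?Sa" for D'
    proof -
      obtain D where D: "D \<in> ?Sa" "D' = D - {a}" using D' by blast
      then show ?thesis using Suc.prems(2)[of D] aD[OF D(1)] by simp
    qed
    obtain R q where R: "finite R" "q > 0" "\<And>b. \<exists>W. R \<union> W \<in> (\<lambda>D. D - {a}) ` ?Sa \<and>
        setless R W \<and> finite W \<and> card W = q \<and> (\<forall>v\<in>W. b < v)"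
      using Suc.IH[OF unc cd] by blast
    have "\<exists>W. insert a R \<union> W \<in> S \<and> setless (insert a R) W \<and> finite W \<and> card W = q \<and> (\<forall>v\<in>W. b < v)" for b
    proof -
      \<comment> \<open>The bound \<open>max a b\<close> keeps the tail above the restored root
        element \<open>a\<close>.\<close>
      obtain W where W: "R \<union> W \<in> (\<lambda>D. D - {a}) ` ?Sa" "setless R W" "finite W" "card W = q"
        "\<forall>v\<in>W. max a b < v" using R(3)[of "max a b"] by (elim exE conjE)
      obtain D where D: "D \<in> ?Sa" "R \<union> W = D - {a}" using W(1) by blast
      then have "insert a R \<union> W = D" using aD[OF D(1)] by blast
      then have "insert a R \<union> W \<in> S" using D(1) by simp
      then show ?thesis using W by (intro exI[of _ W]) (auto simp: setless_def)
    qed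
    then show ?thesis using R(1,2) by (intro exI[of _ "insert a R"] exI[of _ q]) simp
  qed
qed

lemma delta_system:
  assumes "\<not> countable (S :: 'a set set)" "\<forall>D\<in>S. finite D"
  shows "\<exists>R q. finite R \<and> q > 0 \<and>
    (\<forall>b. \<exists>W. R \<union> W \<in> S \<and> setless R W \<and> finite W \<and> card W = q \<and> (\<forall>v\<in>W. b < v))"
proof -
  have "S = (\<Union>c. {D \<in> S. card D = c})" by auto
  then obtain c where c: "\<not> countable {D \<in> S. card D = c}"
    using assms(1) countable_UN[of UNIV "\<lambda>c. {D \<in> S. card D = c}"] by auto
  have "\<exists>R q. finite R \<and> q > 0 \<and>
    (\<forall>b. \<exists>W. R \<union> W \<in> {D \<in> S. card D = c} \<and> setless R W \<and> finite W \<and> card W = q \<and> (\<forall>v\<in>W. b < v))"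
    by (rule delta_system_card[OF c]) (use assms(2) in auto)
  then obtain R q where R: "finite R" "q > 0" "\<And>b. \<exists>W. R \<union> W \<in> {D \<in> S. card D = c} \<and>
      setless R W \<and> finite W \<and> card W = q \<and> (\<forall>v\<in>W. b < v)" by blast
  have "\<exists>W. R \<union> W \<in> S \<and> setless R W \<and> finite W \<and> card W = q \<and> (\<forall>v\<in>W. b < v)" for b
    using R(3)[of b] by auto
  then show ?thesis using R(1,2) by (intro exI[of _ R] exI[of _ q]) simp
qed

end

section \<open>Iterated guessing\<close>

text \<open>A guessed ordinal codes a finite set \<open>U\<close>, read as the pair of the limit \<open>Min U\<close> and a tail above it.\<close>

primrec guess_tuples :: "('a::wellorder set \<Rightarrow> 'a) \<Rightarrow> ('a \<Rightarrow> 'a set) \<Rightarrow> nat \<Rightarrow> 'a \<Rightarrow> 'a set list set" where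
  "guess_tuples e C 0 d = {[]}"
| "guess_tuples e C (Suc s) d =
    {t @ [U - {Min U}] | t U. finite U \<and> U \<noteq> {} \<and> e U \<in> C d \<and> t \<in> guess_tuples e C s (Min U)}"

locale omega1_type = omega1 ty + scheme_type m n r
  for ty :: "'a::wellorder itself" and m n r
begin

text \<open>A catch of \<open>t\<close> by \<open>d\<close> at a high level extends to
  \<open>t @ [W]\<close>, since there \<open>W\<close> shares the piece of \<open>d\<close>. The new
  \<open>e\<close> is the top of the following piece of a full level-\<open>k + 1\<close> hull, and
  the bound on \<open>n\<close> ensures that this piece exists.\<close>

lemma caught_below_Suc:
  fixes h :: "'a \<Rightarrow> nat \<Rightarrow> 'a set"
  assumes ok: "\<And>x. hull_ok T h x" and lim: "is_lim c" and n: "\<forall>k\<ge>K0. Suc s < n k"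
    and T': "\<And>x. x < c \<Longrightarrow> \<exists>d W. x < d \<and> caught_at h (T s d) d \<and> finite W \<and> W \<noteq> {} \<and>
      (\<forall>v\<in>W. d < v \<and> v < c) \<and> (\<forall>t\<in>T s d. length t = s \<and> t @ [W] \<in> T')"
  shows "caught_below h T' c"
  unfolding caught_below_def
proof (intro allI impI)
  fix x Z K assume x: "x < c" and Z: "finite Z \<and> Z \<subseteq> {..<c}"
  have coherent: "\<And>x. coherent h x" using hull_coherent ok by blast
  have "Max (insert x Z) < c" using x Z by auto
  then obtain d W where d: "Max (insert x Z) < d" "caught_at h (T s d) d"
    and W: "finite W" "W \<noteq> {}" "\<forall>v\<in>W. d < v \<and> v < c"
    and t: "\<forall>t\<in>T s d. length t = s \<and> t @ [W] \<in> T'" using T' by blast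
  have xd: "x < d" "finite Z \<and> Z \<subseteq> {..<d}" using d(1) Z by auto
  define u where "u = Max W"
  have u: "u \<in> W" "\<And>v. v \<in> W \<Longrightarrow> v \<le> u" unfolding u_def using W by auto
  have "\<exists>K1. \<forall>k\<ge>K1. insert d W \<subseteq> h u k"
    by (rule eventually_subset[OF coherent]) (use u W in \<open>auto intro: less_imp_le\<close>)
  then obtain K1 where K1: "\<forall>k\<ge>K1. insert d W \<subseteq> h u k" ..
  \<comment> \<open>Levels beyond \<open>K0\<close> have enough pieces, and beyond \<open>K1\<close>
    the hull of \<open>u\<close> contains \<open>d\<close> and \<open>W\<close>.\<close>
  from d(2)[unfolded caught_at_def, rule_format, OF xd, of "max K (max K0 K1)"]
  obtain t y k0 k where tT: "t \<in> T s d" and ct: "catch h t x Z (max K (max K0 K1)) d y k0 k" by blast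
  have k: "max K (max K0 K1) < k0" "k0 < k" using ct by (auto simp: catch_def)
  have len: "length t = s" "t @ [W] \<in> T'" using t tT by auto
  have uc: "u < c" using u(1) W(3) by blast
  obtain f where f: "f < c" "u \<in> h f (Suc k)" "card (h f (Suc k)) = m (Suc k)"
    using full_exists_below[OF lim ok uc] by blast
  have Wk: "insert d W \<subseteq> h u k" using K1 k by simp
  have W': "\<forall>v\<in>W. d < v \<and> v \<in> h u k" and du: "d \<in> h u k" using W(3) Wk by auto
  note tail = catch_tail[OF coherent ct W' du f(2)]
  have "1 \<le> Suc (Suc s)" "Suc (Suc s) \<le> n (Suc k)" using n k by (auto simp: Suc_le_eq)
  from full_block[OF coherent f(3) this] obtain e where e: "e \<in> h f (Suc k)" "xi h k e = Suc (Suc s)"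
    "h e k = {x \<in> h f (Suc k). xi h k x = 0 \<or> xi h k x = Suc (Suc s)}" by blast
  have ec: "e < c" using coherent_le[OF coherent e(1)] f(1) by simp
  have less: "v < e" if "v \<in> h f (Suc k)" "xi h k v < Suc (Suc s)" for v
    using xi_mono[OF coherent e(1) that(1)] e(2) that(2) by fastforce
  have "y < e" "y \<in> h e k" using less tail(1,2) e(3) by auto
  moreover have "v \<le> e \<and> v \<in> h e (Suc k) \<and> xi h k v = Suc i"
    if "i < length (t @ [W])" "v \<in> (t @ [W]) ! i" for i v
  proof -
    have v: "v \<in> h f (Suc k)" "xi h k v = Suc i" using tail(4)[of i v] that by auto
    then have "v < e" using less that(1) len(1) by simp
    then show ?thesis using v coherent_restrict[OF coherent e(1)] by simp
  qed
  ultimately have "catch h (t @ [W]) x Z K e y k0 k"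
    using ct e(2) len(1) k unfolding catch_def by auto
  then show "\<exists>t\<in>T'. \<exists>e<c. \<exists>y k0 k. catch h t x Z K e y k0 k" using len(2) ec by blast
qed

text \<open>By induction on \<open>s\<close>. The limits of stage \<open>s\<close>, each paired with
  a tail above it, yield an uncountable set \<open>X\<close> of codes; a limit \<open>c\<close> that
  guesses \<open>X\<close> and is closed under a suitable function is of stage
  \<open>Suc s\<close>.\<close>

lemma guess_levels_unbounded:
  fixes h :: "'a \<Rightarrow> nat \<Rightarrow> 'a set" and e :: "'a set \<Rightarrow> 'a"
  assumes ok: "\<And>x. hull_ok (guess_tuples e C) h x" and e: "inj_on e {U. finite U \<and> U \<noteq> {}}"
    and C: "\<And>d. is_lim d \<Longrightarrow> C d \<subseteq> {..<d} \<and> (\<forall>b<d. \<exists>g\<in>C d. b \<le> g)"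
    and guess: "\<And>X. \<not> countable X \<Longrightarrow> stationary {d. is_lim d \<and> C d \<subseteq> X}"
    and W: "\<And>b. \<exists>W\<in>\<W>. finite W \<and> W \<noteq> {} \<and> (\<forall>v\<in>W. b < v)"
    and n: "\<forall>k\<ge>K0. s < n k"
  shows "\<exists>d>b. is_lim d \<and> caught_at h (guess_tuples e C s d) d \<and>
    (\<forall>t\<in>guess_tuples e C s d. length t = s \<and> set t \<subseteq> \<W>)"
  using n
proof (induction s arbitrary: b)
  case 0
  obtain d where d: "d \<in> {c. is_lim c \<and> b < c \<and> (\<forall>x<c. id x < c)}"
    using club_closure_points[of b id] unfolding club_def by blast
  then have "caught_below h {[]} d" using caught_below_Nil ok by blast
  then have "caught_at h (guess_tuples e C 0 d) d" using hull_lim[OF ok, of d 0] d by simp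
  then show ?case using d by auto
next
  case (Suc s)
  define Z where "Z = {d. is_lim d \<and> caught_at h (guess_tuples e C s d) d \<and>
    (\<forall>t\<in>guess_tuples e C s d. length t = s \<and> set t \<subseteq> \<W>)}"
  have "\<forall>k\<ge>K0. s < n k" using Suc.prems by (meson Suc_lessD)
  then have Zunb: "\<exists>d\<in>Z. b < d" for b using Suc.IH[of b] unfolding Z_def by blast
  obtain Wf where Wf: "\<And>d. Wf d \<in> \<W> \<and> finite (Wf d) \<and> Wf d \<noteq> {} \<and> (\<forall>v\<in>Wf d. d < v)"
    using W by metis
  define U where "U d = insert d (Wf d)" for d
  have Min_U: "Min (U d) = d" for d
    unfolding U_def using Wf by (intro Min_eqI) (auto intro: less_imp_le)
  have U_diff: "U d - {d} = Wf d" for d unfolding U_def using Wf by blast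
  have U: "U d \<in> {U. finite U \<and> U \<noteq> {}}" for d unfolding U_def using Wf by simp
  have U_inj: "d = d'" if "e (U d) = e (U d')" for d d'
    using inj_onD[OF e that U U] Min_U by metis
  define X where "X = (\<lambda>d. e (U d)) ` Z"
  have "inj_on (\<lambda>d. e (U d)) Z" by (rule inj_onI) (rule U_inj)
  then have "\<not> countable X"
    unfolding X_def using unbounded_uncountable[of Z] Zunb countable_image_inj_on by blast
  then have st: "stationary {d. is_lim d \<and> C d \<subseteq> X}" by (rule guess)
  \<comment> \<open>This yields a function \<open>g\<close> relating codes to what they code: a code
    that is at least \<open>g x\<close> belongs to a pair whose limit exceeds \<open>x\<close>, and
    \<open>g\<close> of a code bounds the coded set. Below a closure point \<open>c\<close>, the
    guessed limits are then cofinal and the guessed tails stay below \<open>c\<close>.\<close>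
  have "\<exists>u. (\<forall>d\<le>x. e (U d) < u) \<and> (\<forall>d. e (U d) = x \<longrightarrow> (\<forall>v\<in>U d. v < u))" for x
  proof -
    let ?V = "{v. \<exists>d. e (U d) = x \<and> v \<in> U d}"
    have "countable ?V"
    proof (cases "\<exists>d. e (U d) = x")
      case True
      then obtain d0 where d0: "e (U d0) = x" ..
      have "?V \<subseteq> U d0"
      proof
        fix v assume "v \<in> ?V"
        then obtain d where "e (U d) = x" "v \<in> U d" by blast
        then show "v \<in> U d0" using U_inj[of d d0] d0 by simp
      qed
      moreover have "countable (U d0)" using U[of d0] countable_finite by blast
      ultimately show ?thesis using countable_subset by blast
    qed simp
    then have "countable ((\<lambda>d. e (U d)) ` {..x} \<union> ?V)"
      using countable_initial(2) by simp
    from countable_bounded[OF this]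
    obtain u where u: "\<forall>a\<in>(\<lambda>d. e (U d)) ` {..x} \<union> ?V. a < u" ..
    show ?thesis
    proof (intro exI[of _ u] conjI allI impI ballI)
      show "e (U d) < u" if "d \<le> x" for d using u that by simp
      show "v < u" if "e (U d) = x" "v \<in> U d" for d v using u that by blast
    qed
  qed
  then have "\<exists>g. \<forall>x. (\<forall>d\<le>x. e (U d) < g x) \<and> (\<forall>d. e (U d) = x \<longrightarrow> (\<forall>v\<in>U d. v < g x))"
    by (intro choice allI)
  then obtain g where g': "\<forall>x. (\<forall>d\<le>x. e (U d) < g x) \<and> (\<forall>d. e (U d) = x \<longrightarrow> (\<forall>v\<in>U d. v < g x))" ..
  then have g: "\<And>x d. d \<le> x \<Longrightarrow> e (U d) < g x" "\<And>d v. v \<in> U d \<Longrightarrow> v < g (e (U d))" by auto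
  have "{d. is_lim d \<and> C d \<subseteq> X} \<inter> {c. is_lim c \<and> b < c \<and> (\<forall>x<c. g x < c)} \<noteq> {}"
    using st[unfolded stationary_def, rule_format, OF club_closure_points] .
  then obtain c where c: "is_lim c" "C c \<subseteq> X" "b < c" "\<And>x. x < c \<Longrightarrow> g x < c" by auto
  \<comment> \<open>As \<open>C c\<close> contains only codes from \<open>X\<close> and
    \<open>e\<close> is injective, no unintended tuple occurs at \<open>c\<close>.\<close>
  have tup: "\<exists>d\<in>Z. \<exists>t'\<in>guess_tuples e C s d. t = t' @ [Wf d]"
    if t: "t \<in> guess_tuples e C (Suc s) c" for t
  proof -
    obtain t' V where V: "t = t' @ [V - {Min V}]" "finite V" "V \<noteq> {}" "e V \<in> C c"
      "t' \<in> guess_tuples e C s (Min V)" using t by auto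
    obtain d where d: "d \<in> Z" "e V = e (U d)" using V(4) c(2) unfolding X_def by blast
    have "V = U d" using inj_onD[OF e d(2)] V(2,3) U by blast
    then have "t = t' @ [Wf d]" "t' \<in> guess_tuples e C s d" using V(1,5) Min_U[of d] U_diff[of d] by simp_all
    then show ?thesis using d(1) by blast
  qed
  have "caught_below h (guess_tuples e C (Suc s) c) c"
  proof (rule caught_below_Suc[OF ok c(1) Suc.prems])
    fix x assume "x < c"
    then have "g x < c" using c(4) by blast
    then obtain y where y: "y \<in> C c" "g x \<le> y" using C[OF c(1)] by blast
    obtain d where d: "d \<in> Z" "y = e (U d)" using y(1) c(2) unfolding X_def by blast
    have "x < d"
    proof (rule ccontr)
      assume "\<not> x < d"
      then have "e (U d) < g x" using g(1) by simp
      then show False using y(2) d(2) by simp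
    qed
    moreover have "v < c" if v: "v \<in> Wf d" for v
    proof -
      have "y < c" using y(1) C[OF c(1)] by blast
      then have "g y < c" using c(4) by blast
      moreover have "v < g y" using g(2)[of v d] v d(2) unfolding U_def by simp
      ultimately show ?thesis by simp
    qed
    moreover have "t @ [Wf d] \<in> guess_tuples e C (Suc s) c" if t: "t \<in> guess_tuples e C s d" for t
    proof -
      have "t @ [U d - {Min (U d)}] \<in> guess_tuples e C (Suc s) c"
        using U[of d] y(1) d(2) t Min_U[of d] by auto
      then show ?thesis using Min_U U_diff by simp
    qed
    ultimately show "\<exists>d W. x < d \<and> caught_at h (guess_tuples e C s d) d \<and> finite W \<and> W \<noteq> {} \<and>
      (\<forall>v\<in>W. d < v \<and> v < c) \<and> (\<forall>t\<in>guess_tuples e C s d. length t = s \<and> t @ [W] \<in> guess_tuples e C (Suc s) c)"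
      using d(1) Wf[of d] unfolding Z_def by (intro exI[of _ d] exI[of _ "Wf d"]) blast
  qed
  then have "caught_at h (guess_tuples e C (Suc s) c) c" using hull_lim[OF ok c(1)] by blast
  moreover have "length t = Suc s \<and> set t \<subseteq> \<W>" if t: "t \<in> guess_tuples e C (Suc s) c" for t
  proof -
    obtain d t' where "d \<in> Z" "t' \<in> guess_tuples e C s d" "t = t' @ [Wf d]" using tup[OF t] by blast
    then show ?thesis using Wf[of d] unfolding Z_def by auto
  qed
  ultimately show ?case using c(1,3) by blast
qed

text \<open>Some \<open>d\<close> above the root \<open>R\<close> of a \<Delta>-system catches
  tuples of \<open>len - 1\<close> tails, and any tail above \<open>d\<close> completes them.
  Catches by \<open>d\<close> occur beyond every level \<open>K\<close>, so infinitely many levels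
  capture.\<close>

lemma n_rho_capturing_hull:
  fixes h :: "'a \<Rightarrow> nat \<Rightarrow> 'a set" and e :: "'a set \<Rightarrow> 'a"
  assumes ok: "\<And>x. hull_ok (guess_tuples e C) h x" and e: "inj_on e {U. finite U \<and> U \<noteq> {}}"
    and C: "\<And>d. is_lim d \<Longrightarrow> C d \<subseteq> {..<d} \<and> (\<forall>b<d. \<exists>g\<in>C d. b \<le> g)"
    and guess: "\<And>X. \<not> countable X \<Longrightarrow> stationary {d. is_lim d \<and> C d \<subseteq> X}"
    and len: "len \<ge> 2" and n: "\<forall>k\<ge>K0. len \<le> n k"
  shows "n_rho_capturing len m n r (hull_family h)"
  unfolding n_rho_capturing_def
proof (intro allI impI)
  fix S :: "'a set set" assume S: "\<not> countable S \<and> (\<forall>D\<in>S. D \<noteq> {} \<and> finite D)"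
  then have S1: "\<not> countable S" and S2: "\<forall>D\<in>S. finite D" by auto
  have coherent: "\<And>x. coherent h x" using hull_coherent ok by blast
  obtain R q where R: "finite R" "q > 0"
    "\<forall>b. \<exists>W. R \<union> W \<in> S \<and> setless R W \<and> finite W \<and> card W = q \<and> (\<forall>v\<in>W. b < v)"
    using delta_system[OF S1 S2] by (elim exE conjE)
  define \<W> where "\<W> = {W. R \<union> W \<in> S \<and> setless R W \<and> finite W \<and> card W = q}"
  have Wex: "\<exists>W\<in>\<W>. finite W \<and> W \<noteq> {} \<and> (\<forall>v\<in>W. b < v)" for b
  proof -
    obtain W where W: "R \<union> W \<in> S" "setless R W" "finite W" "card W = q" "\<forall>v\<in>W. b < v"
      using R(3)[rule_format, of b] by (elim exE conjE)
    then have "W \<noteq> {}" using R(2) by auto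
    then show ?thesis using W unfolding \<W>_def by blast
  qed
  obtain s where s: "len = Suc s" "s \<ge> 1" using len by (cases len) auto
  \<comment> \<open>The least point is the default when \<open>R\<close> is empty.\<close>
  define x where "x = Max (insert (LEAST z. True) R)"
  have x: "\<And>z. z \<in> R \<Longrightarrow> z \<le> x" unfolding x_def using R(1) by simp
  have "\<forall>k\<ge>K0. s < n k" using n s by (simp add: Suc_le_eq)
  from guess_levels_unbounded[OF ok e C guess Wex this, of x]
  obtain d where d: "x < d" "caught_at h (guess_tuples e C s d) d"
    "\<And>t. t \<in> guess_tuples e C s d \<Longrightarrow> length t = s \<and> set t \<subseteq> \<W>" by blast
  obtain W where W: "W \<in> \<W>" "finite W" "W \<noteq> {}" "\<forall>v\<in>W. d < v" using Wex by blast
  define u where "u = Max W"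
  have u: "u \<in> W" "\<And>v. v \<in> W \<Longrightarrow> v \<le> u" unfolding u_def using W by auto
  have "\<exists>K1. \<forall>k\<ge>K1. insert d W \<subseteq> h u k"
    by (rule eventually_subset[OF coherent]) (use u W in \<open>auto intro: less_imp_le\<close>)
  then obtain K1 where K1: "\<forall>k\<ge>K1. insert d W \<subseteq> h u k" ..
  obtain K2 where K2: "\<forall>k\<ge>K2. R \<subseteq> h x k" using eventually_subset[OF coherent R(1) x] by blast
  have "\<exists>l>K. \<exists>D. inj_on D {..<len} \<and> D ` {..<len} \<subseteq> S \<and> rho_captured m n r (hull_family h) D len l" for K
  proof -
    \<comment> \<open>With this choice of \<open>x\<close> the hull of \<open>y\<close> at level
      \<open>k0\<close> contains \<open>x\<close> and, beyond \<open>K2\<close>, all of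
      \<open>R\<close>; so \<open>R\<close> ends up in the root. No further point has to reach
      \<open>y\<close>, hence \<open>Z\<close> is empty.\<close>
    from d(2)[unfolded caught_at_def, rule_format, OF d(1), of "{}" "max K (max K1 K2)"]
    obtain t y k0 k where t: "t \<in> guess_tuples e C s d" and ct: "catch h t x {} (max K (max K1 K2)) d y k0 k"
      by auto
    have k: "max K (max K1 K2) < k0" "k0 < k" and xy: "x \<in> h y k0" using ct by (auto simp: catch_def branches_off_def)
    obtain f where f: "u \<in> h f (Suc k)" "card (h f (Suc k)) = m (Suc k)"
      using full_exists[of UNIV "guess_tuples e C" h u "Suc k"] ok succ_exists by auto
    have Wk: "insert d W \<subseteq> h u k" using K1 k by simp
    have W': "\<forall>v\<in>W. d < v \<and> v \<in> h u k" and du: "d \<in> h u k" using W(4) Wk by auto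
    note tail = catch_tail[OF coherent ct W' du f(1)]
    define tt where "tt = t @ [W]"
    have tl: "length tt = len" unfolding tt_def using d(3)[OF t] s by simp
    have ttW: "tt ! i \<in> \<W>" if "i < len" for i
    proof -
      have "tt ! i \<in> set tt" using that tl by (intro nth_mem) simp
      then show ?thesis using d(3)[OF t] W(1) unfolding tt_def by auto
    qed
    have RE: "z \<in> h f (Suc k) \<and> xi h k z = 0" if z: "z \<in> R" for z
    proof -
      have "R \<subseteq> h x k0" using K2[rule_format, of k0] k(1) by simp
      then have zy: "z \<in> h y k" using z coherent_sub[OF coherent xy] coherent_mono[OF coherent, of k0 k y] k(2) by auto
      then have "xi h k z = 0" using coherent_xi[OF coherent zy] tail(2) by simp
      then show ?thesis using zy tail(3) by blast
    qed
    have ttE: "v \<in> h f (Suc k) \<and> xi h k v = Suc i" if "i < length tt" "v \<in> tt ! i" for i v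
      using tail(4)[of i v] that unfolding tt_def by simp
    let ?D = "\<lambda>i. R \<union> tt ! i"
    have "rho_captured m n r (hull_family h) ?D (length tt) (Suc k)"
    proof (rule rho_captured_hull[OF coherent f(2) _ R(1) RE _ R(2) ttE])
      show "2 \<le> length tt" using tl len by simp
      show "finite (tt ! i) \<and> card (tt ! i) = q \<and> setless R (tt ! i)" if "i < length tt" for i
        using ttW[of i] that tl by (simp add: \<W>_def)
    qed
    moreover have "inj_on ?D {..<len}"
    proof (rule inj_onI)
      fix i j assume ij: "i \<in> {..<len}" "j \<in> {..<len}" and eq: "?D i = ?D j"
      then have "card (tt ! i) = q" using ttW[of i] by (simp add: \<W>_def)
      then obtain v where v: "v \<in> tt ! i" using R(2) by fastforce
      then have xv: "xi h k v = Suc i" using ttE ij tl by simp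
      then have "v \<notin> R" using RE[of v] by auto
      then have "v \<in> tt ! j" using v eq by blast
      then have "xi h k v = Suc j" using ttE ij tl by simp
      then show "i = j" using xv by simp
    qed
    moreover have "?D ` {..<len} \<subseteq> S" using ttW unfolding \<W>_def by auto
    moreover have "Suc k > K" using k by simp
    ultimately show ?thesis using tl by (intro exI[of _ "Suc k"] conjI exI[of _ ?D]) simp_all
  qed
  then show "infinite {l. \<exists>D. inj_on D {..<len} \<and> D ` {..<len} \<subseteq> S \<and> rho_captured m n r (hull_family h) D len l}"
    unfolding infinite_nat_iff_unbounded by blast
qed

text \<open>One recursion treats the tuple sets of all stages \<open>s\<close>, so a single scheme
  serves every length that \<open>n\<close> eventually reaches; both claims of the theorem are
  instances.\<close>

theorem capturing_scheme_exists:
  assumes "clubsuit TYPE('a)"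
  shows "\<exists>\<F> :: 'a set set. construction_scheme m n r UNIV \<F> \<and>
    (\<forall>len\<ge>2. (\<exists>K. \<forall>k\<ge>K. len \<le> n k) \<longrightarrow> n_rho_capturing len m n r \<F>)"
proof -
  obtain C :: "'a \<Rightarrow> 'a set" where
    C1: "\<forall>d. is_lim d \<longrightarrow> C d \<subseteq> {b. b < d} \<and> order_type_omega (C d) \<and> (\<forall>b<d. \<exists>g\<in>C d. b \<le> g)"
    and C2: "\<forall>X. \<not> countable X \<longrightarrow> stationary {d. is_lim d \<and> C d \<subseteq> X}"
    using assms unfolding clubsuit_def by (elim exE conjE)
  have C: "\<And>d. is_lim d \<Longrightarrow> C d \<subseteq> {..<d} \<and> (\<forall>b<d. \<exists>g\<in>C d. b \<le> g)"
    using C1 unfolding lessThan_def by simp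
  have guess: "\<And>X. \<not> countable X \<Longrightarrow> stationary {d. is_lim d \<and> C d \<subseteq> X}" using C2 by simp
  obtain e :: "'a set \<Rightarrow> 'a" where e: "inj_on e {U. finite U \<and> U \<noteq> {}}" using inj_finite_sets ..
  obtain h :: "'a \<Rightarrow> nat \<Rightarrow> 'a set" where h: "\<And>x. hull_ok (guess_tuples e C) h x"
    using hull_exists[OF countable_initial(1)] by blast
  have "n_rho_capturing len m n r (hull_family h)" if "len \<ge> 2" "\<exists>K. \<forall>k\<ge>K. len \<le> n k" for len
    using n_rho_capturing_hull[OF h e C guess that(1)] that(2) by blast
  then show ?thesis using hull_scheme[OF h succ_exists] by blast
qed

end

theorem mainTheorem9:
  assumes "omega1_like TYPE('a::wellorder)"
    and "clubsuit TYPE('a)"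
  shows "(\<forall>len m n r. len \<ge> 2 \<and> good_type m n r \<and> (\<forall>k\<ge>1. n k \<ge> len) \<longrightarrow>
            (\<exists>\<F> :: 'a set set. construction_scheme m n r UNIV \<F> \<and> n_rho_capturing len m n r \<F>))
       \<and> (\<forall>m n r. good_type m n r \<and> mono (\<lambda>k. n (Suc k)) \<and> (\<forall>b. \<exists>k. n (Suc k) > b) \<longrightarrow>
            (\<exists>\<F> :: 'a set set. construction_scheme m n r UNIV \<F> \<and> rho_capturing m n r \<F>))"
proof -
  have ex: "\<exists>\<F> :: 'a set set. construction_scheme m n r UNIV \<F> \<and>
      (\<forall>len\<ge>2. (\<exists>K. \<forall>k\<ge>K. len \<le> n k) \<longrightarrow> n_rho_capturing len m n r \<F>)"
    if good: "good_type m n r" for m n r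
  proof -
    interpret omega1_type "TYPE('a)" m n r by unfold_locales (rule assms(1), rule good)
    show ?thesis by (rule capturing_scheme_exists[OF assms(2)])
  qed
  show ?thesis
  proof (intro conjI allI impI)
    fix len :: nat and m n r :: "nat \<Rightarrow> nat"
    assume a: "len \<ge> 2 \<and> good_type m n r \<and> (\<forall>k\<ge>1. n k \<ge> len)"
    then show "\<exists>\<F> :: 'a set set. construction_scheme m n r UNIV \<F> \<and> n_rho_capturing len m n r \<F>"
      using ex[of m n r] by blast
  next
    fix m n r :: "nat \<Rightarrow> nat"
    assume a: "good_type m n r \<and> mono (\<lambda>k. n (Suc k)) \<and> (\<forall>b. \<exists>k. n (Suc k) > b)"
    have "\<exists>K. \<forall>k\<ge>K. len \<le> n k" for len
    proof -
      obtain j where j: "len < n (Suc j)" using a by blast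
      have "len \<le> n k" if "Suc j \<le> k" for k
      proof -
        obtain i where i: "k = Suc i" "j \<le> i" using \<open>Suc j \<le> k\<close> by (cases k) auto
        have "n (Suc j) \<le> n (Suc i)" using a i(2) by (auto dest: monoD)
        then show ?thesis using j i(1) by simp
      qed
      then show ?thesis by blast
    qed
    then show "\<exists>\<F> :: 'a set set. construction_scheme m n r UNIV \<F> \<and> rho_capturing m n r \<F>"
      using ex[of m n r] a unfolding rho_capturing_def by blast
  qed
qed

end
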